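(* Let $n\ge1$. The elements $\tilde T_{1,a_1}\tilde T_{2,a_2}\cdots \tilde T_{n-1,a_{n-1}}$ and $z\tilde T_{1,a_1}\tilde T_{2,a_2}\cdots \tilde T_{n-1,a_{n-1}}$, where $0 \le a_i\le i$ for $1 \le i \le n-1$, form a basis of the $\mathbb{C}(q)$-vector space $\mathcal{H}_n^{\sim}$. Also, $\dim \mathcal{H}_n^{\sim} =2\,n!$.
   Context: Let $q$ be a formal parameter and $\varepsilon=q-q^{-1}$. The covering Hecke algebra $\mathcal{H}_n^{\sim}$ is the unital associative $\mathbb{C}(q)$-algebra generated by $z$ and $\tilde T_i$ $(1\le i\le n-1)$ subject to: $z^2=1$ and $z$ is central; $\tilde T_i^2=z(q^2+q^{-2}+1)+1$; $\tilde T_i\tilde T_j=z\tilde T_j\tilde T_i$ for $|i-j|>1$; $\tilde T_i\tilde T_{i+1}\tilde T_i-\tilde T_{i+1}\tilde T_i\tilde T_{i+1}=\varepsilon^2(\tilde T_{i+1}-\tilde T_i)$. (It is a superalgebra with $z$ even and $\tilde T_i$ odd.) For $1\le i\le n-1$ and $0\le a\le i$ put $\tilde T_{i,a}:=\tilde T_i\tilde T_{i-1}\cdots\tilde T_{i-a+1}$ (a product of $a$ generators), with $\tilde T_{i,0}=1$. Dimension is over $\mathbb{C}(q)$. *)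

theory Defs
  imports
    "Jordan_Normal_Form.VS_Connect"
    "HOL-Algebra.QuotRing"
    "HOL-Library.Poly_Mapping"
    "HOL-Computational_Algebra.Fraction_Field"
begin

section \<open>Free associative algebras\<close>

text \<open>The free monoid on \<open>'x\<close>, written additively: the convolution product of
  \<open>Poly_Mapping\<close> needs a (not necessarily commutative) \<open>monoid_add\<close> of exponents.\<close>

datatype 'x word = Word (letters: "'x list")

instantiation word :: (type) monoid_add
begin
definition zero_word :: "'a word" where "0 = Word []"
definition plus_word :: "'a word \<Rightarrow> 'a word \<Rightarrow> 'a word"
  where "u + v = Word (letters u @ letters v)"
instance
  by standard (simp_all add: zero_word_def plus_word_def)
end

type_synonym ('x, 'k) ncpoly = "'x word \<Rightarrow>\<^sub>0 'k"

definition scalar :: "'k::field \<Rightarrow> ('x, 'k) ncpoly"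
  where "scalar c = Poly_Mapping.single 0 c"

definition letter :: "'x \<Rightarrow> ('x, 'k::field) ncpoly"
  where "letter x = Poly_Mapping.single (Word [x]) 1"

definition free_algebra :: "'x set \<Rightarrow> ('k::field, ('x, 'k) ncpoly) module"
  where "free_algebra X =
    \<lparr>carrier = {p. \<forall>w \<in> Poly_Mapping.keys p. set (letters w) \<subseteq> X},
     mult = (*), one = 1, zero = 0, add = (+),
     smult = (\<lambda>c p. scalar c * p)\<rparr>"

text \<open>The quotient \<open>A Quot I\<close> of an algebra by a two-sided ideal, with the induced scalar
  multiplication (formed like \<^const>\<open>rcoset_mult\<close>).\<close>

definition quot_algebra :: "('k, 'a) module \<Rightarrow> 'a set \<Rightarrow> ('k, 'a set) module"
  where "quot_algebra A I =
    \<lparr>carrier = carrier (A Quot I), mult = mult (A Quot I), one = one (A Quot I),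
     zero = zero (A Quot I), add = add (A Quot I),
     smult = (\<lambda>c U. \<Union>u\<in>U. I +>\<^bsub>A\<^esub> (c \<odot>\<^bsub>A\<^esub> u))\<rparr>"

section \<open>The covering Hecke algebra\<close>

type_synonym ratfun = "complex poly fract"

definition hecke_q :: ratfun where "hecke_q = Fract [:0, 1:] 1"

definition hecke_eps :: ratfun where "hecke_eps = hecke_q - inverse hecke_q"

datatype hecke_gen = Gen_z | Gen_T nat

definition hecke_gens :: "nat \<Rightarrow> hecke_gen set"
  where "hecke_gens n = insert Gen_z (Gen_T ` {1..<n})"

abbreviation hecke_free :: "nat \<Rightarrow> (ratfun, (hecke_gen, ratfun) ncpoly) module"
  where "hecke_free n \<equiv> free_algebra (hecke_gens n)"

abbreviation fz :: "(hecke_gen, ratfun) ncpoly" where "fz \<equiv> letter Gen_z"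
abbreviation fT :: "nat \<Rightarrow> (hecke_gen, ratfun) ncpoly" where "fT i \<equiv> letter (Gen_T i)"

text \<open>Each relation \<open>l = r\<close> is recorded as the element \<open>l - r\<close> of the free algebra.\<close>

definition hecke_rels :: "nat \<Rightarrow> (hecke_gen, ratfun) ncpoly set"
  where "hecke_rels n =
    {fz * fz - 1}
    \<union> {fz * p - p * fz | p. p \<in> carrier (hecke_free n)}
    \<union> {fT i * fT i - (scalar (hecke_q^2 + inverse hecke_q^2 + 1) * fz + 1) | i. i \<in> {1..<n}}
    \<union> {fT i * fT j - fz * fT j * fT i | i j.
          i \<in> {1..<n} \<and> j \<in> {1..<n} \<and> \<bar>int i - int j\<bar> > 1}
    \<union> {(fT i * fT (i+1) * fT i - fT (i+1) * fT i * fT (i+1))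
          - scalar (hecke_eps^2) * (fT (i+1) - fT i) | i. i \<in> {1..<n} \<and> i + 1 \<in> {1..<n}}"

definition hecke_ideal :: "nat \<Rightarrow> (hecke_gen, ratfun) ncpoly set"
  where "hecke_ideal n = Idl\<^bsub>hecke_free n\<^esub> (hecke_rels n)"

definition covering_hecke :: "nat \<Rightarrow> (ratfun, (hecke_gen, ratfun) ncpoly set) module"
  where "covering_hecke n = quot_algebra (hecke_free n) (hecke_ideal n)"

definition hecke_z :: "nat \<Rightarrow> (hecke_gen, ratfun) ncpoly set"
  where "hecke_z n = hecke_ideal n +>\<^bsub>hecke_free n\<^esub> fz"

definition hecke_T :: "nat \<Rightarrow> nat \<Rightarrow> (hecke_gen, ratfun) ncpoly set"
  where "hecke_T n i = hecke_ideal n +>\<^bsub>hecke_free n\<^esub> fT i"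

text \<open>\<open>hecke_Tdesc n i a\<close> is the descending product \<open>T_i T_(i-1) ... T_(i-a+1)\<close> of \<open>a\<close> generators
  (meaningful for \<open>a \<le> i < n\<close>).\<close>

primrec hecke_Tdesc :: "nat \<Rightarrow> nat \<Rightarrow> nat \<Rightarrow> (hecke_gen, ratfun) ncpoly set"
  where
    "hecke_Tdesc n i 0 = \<one>\<^bsub>covering_hecke n\<^esub>"
  | "hecke_Tdesc n i (Suc a) = hecke_Tdesc n i a \<otimes>\<^bsub>covering_hecke n\<^esub> hecke_T n (i - a)"

text \<open>\<open>hecke_Tprod n a k\<close> is the ordered product of the \<open>hecke_Tdesc n i (a i)\<close> for
  \<open>i = 1, ..., k\<close>.\<close>

primrec hecke_Tprod :: "nat \<Rightarrow> (nat \<Rightarrow> nat) \<Rightarrow> nat \<Rightarrow> (hecke_gen, ratfun) ncpoly set"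
  where
    "hecke_Tprod n a 0 = \<one>\<^bsub>covering_hecke n\<^esub>"
  | "hecke_Tprod n a (Suc k) =
       hecke_Tprod n a k \<otimes>\<^bsub>covering_hecke n\<^esub> hecke_Tdesc n (Suc k) (a (Suc k))"

text \<open>The exponent sequences \<open>(a_1, ..., a_(n-1))\<close> with \<open>0 \<le> a_i \<le> i\<close>; extensionality makes
  distinct functions distinct sequences.\<close>

definition hecke_exps :: "nat \<Rightarrow> (nat \<Rightarrow> nat) set"
  where "hecke_exps n = (\<Pi>\<^sub>E i\<in>{1..n-1}. {0..i})"

section \<open>The covering Hecke algebra is an algebra\<close>

lemma scalar_add: "scalar (a + b) = scalar a + scalar b"
  by (simp add: scalar_def single_add)

lemma scalar_mult: "scalar (a * b) = scalar a * scalar b"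
  by (simp add: scalar_def mult_single)

lemma scalar_one: "scalar 1 = 1"
  by (simp add: scalar_def)

lemma scalar_central: "scalar c * p = p * scalar c"
proof (induction p rule: update_induct)
  case const
  show ?case by simp
next
  case (update f a b)
  have "Poly_Mapping.update a b f = f + Poly_Mapping.single a b"
    using update by (intro poly_mapping_eqI)
      (auto simp: lookup_update lookup_add lookup_single in_keys_iff when_def)
  then show ?case
    using update
    by (simp add: distrib_left distrib_right scalar_def mult_single mult.commute)
qed

lemma scalar_left_commute: "p * (scalar c * r) = scalar c * (p * r)"
  by (metis mult.assoc scalar_central)

lemma free_algebra_simps [simp]:
  "mult (free_algebra X) = (*)" "one (free_algebra X) = 1" "zero (free_algebra X) = 0"
  "add (free_algebra X) = (+)" "smult (free_algebra X) = (\<lambda>c p. scalar c * p)"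
  by (simp_all add: free_algebra_def)

lemma free_algebra_carrierI:
  "(\<And>w. w \<in> Poly_Mapping.keys p \<Longrightarrow> set (letters w) \<subseteq> X) \<Longrightarrow> p \<in> carrier (free_algebra X)"
  by (simp add: free_algebra_def)

lemma free_algebra_carrierD:
  "p \<in> carrier (free_algebra X) \<Longrightarrow> w \<in> Poly_Mapping.keys p \<Longrightarrow> set (letters w) \<subseteq> X"
  by (simp add: free_algebra_def)

lemma free_algebra_closed:
  shows "0 \<in> carrier (free_algebra X)" "1 \<in> carrier (free_algebra X)"
    and "scalar c \<in> carrier (free_algebra X)"
    and "x \<in> X \<Longrightarrow> letter x \<in> carrier (free_algebra X)"
    and "p \<in> carrier (free_algebra X) \<Longrightarrow> - p \<in> carrier (free_algebra X)"
    and "p \<in> carrier (free_algebra X) \<Longrightarrow> r \<in> carrier (free_algebra X) \<Longrightarrow>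
      p + r \<in> carrier (free_algebra X)"
    and "p \<in> carrier (free_algebra X) \<Longrightarrow> r \<in> carrier (free_algebra X) \<Longrightarrow>
      p - r \<in> carrier (free_algebra X)"
    and "p \<in> carrier (free_algebra X) \<Longrightarrow> r \<in> carrier (free_algebra X) \<Longrightarrow>
      p * r \<in> carrier (free_algebra X)"
proof -
  show "0 \<in> carrier (free_algebra X)" by (rule free_algebra_carrierI) simp
  show "1 \<in> carrier (free_algebra X)"
    by (rule free_algebra_carrierI) (simp add: zero_word_def)
  show "scalar c \<in> carrier (free_algebra X)"
    by (rule free_algebra_carrierI) (simp add: scalar_def zero_word_def split: if_splits)
  show "x \<in> X \<Longrightarrow> letter x \<in> carrier (free_algebra X)"
    by (rule free_algebra_carrierI) (simp add: letter_def)
  show "p \<in> carrier (free_algebra X) \<Longrightarrow> - p \<in> carrier (free_algebra X)"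
    by (rule free_algebra_carrierI) (auto simp: in_keys_iff dest: free_algebra_carrierD)
  show "p \<in> carrier (free_algebra X) \<Longrightarrow> r \<in> carrier (free_algebra X) \<Longrightarrow>
      p + r \<in> carrier (free_algebra X)"
    by (rule free_algebra_carrierI) (metis free_algebra_carrierD keys_add Un_iff subsetD)
  show "p \<in> carrier (free_algebra X) \<Longrightarrow> r \<in> carrier (free_algebra X) \<Longrightarrow>
      p - r \<in> carrier (free_algebra X)"
    by (rule free_algebra_carrierI) (metis free_algebra_carrierD keys_diff Un_iff subsetD)
  show "p * r \<in> carrier (free_algebra X)"
    if p: "p \<in> carrier (free_algebra X)" and r: "r \<in> carrier (free_algebra X)"
  proof (rule free_algebra_carrierI)
    fix w assume "w \<in> Poly_Mapping.keys (p * r)"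
    then obtain u v where "w = u + v" "u \<in> Poly_Mapping.keys p" "v \<in> Poly_Mapping.keys r"
      using keys_mult[of p r] by blast
    then show "set (letters w) \<subseteq> X"
      using free_algebra_carrierD[OF p] free_algebra_carrierD[OF r] by (simp add: plus_word_def)
  qed
qed

lemma ring_free_algebra: "ring (free_algebra X)"
proof (rule ringI)
  show "abelian_group (free_algebra X)"
  proof (rule abelian_groupI, goal_cases)
    case (6 x)
    then show ?case
      using free_algebra_closed(5)[of x X] by (intro bexI[of _ "- x"]) auto
  qed (auto simp: free_algebra_closed algebra_simps)
  show "Group.monoid (free_algebra X)"
    by (rule monoidI) (auto simp: free_algebra_closed algebra_simps)
qed (auto simp: algebra_simps)

lemma hecke_rels_subset: "hecke_rels n \<subseteq> carrier (hecke_free n)"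
  by (auto simp: hecke_rels_def hecke_gens_def intro!: free_algebra_closed)

lemma ideal_hecke_ideal: "ideal (hecke_ideal n) (hecke_free n)"
  unfolding hecke_ideal_def
  by (rule ring.genideal_ideal[OF ring_free_algebra hecke_rels_subset])

lemma quot_algebra_simps:
  "carrier (quot_algebra A I) = carrier (A Quot I)"
  "mult (quot_algebra A I) = mult (A Quot I)" "one (quot_algebra A I) = one (A Quot I)"
  "zero (quot_algebra A I) = zero (A Quot I)" "add (quot_algebra A I) = add (A Quot I)"
  by (simp_all add: quot_algebra_def)

lemma ring_quot_algebra:
  assumes "ideal I A"
  shows "ring (quot_algebra A I)"
proof -
  interpret R: ring "A Quot I" using assms by (rule ideal.quotient_is_ring)
  show ?thesis
  proof (rule ringI)
    show "abelian_group (quot_algebra A I)"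
      by (rule abelian_groupI) (auto simp: quot_algebra_simps R.add.m_ac R.add.l_inv_ex)
    show "Group.monoid (quot_algebra A I)"
      by (rule monoidI) (auto simp: quot_algebra_simps R.m_assoc)
  qed (auto simp: quot_algebra_simps R.l_distr R.r_distr)
qed

lemma quot_free_smult:
  assumes I: "ideal I (free_algebra X)" and p: "p \<in> carrier (free_algebra X)"
  shows "c \<odot>\<^bsub>quot_algebra (free_algebra X) I\<^esub> (I +>\<^bsub>free_algebra X\<^esub> p) =
    I +>\<^bsub>free_algebra X\<^esub> (scalar c * p)"
proof -
  interpret ideal I "free_algebra X" by (rule I)
  have eq: "I +>\<^bsub>free_algebra X\<^esub> (scalar c * u) = I +>\<^bsub>free_algebra X\<^esub> (scalar c * p)"
    if u: "u \<in> I +>\<^bsub>free_algebra X\<^esub> p" for u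
  proof -
    obtain i where i: "i \<in> I" "u = i + p"
      using u by (auto simp: a_r_coset_def')
    have "scalar c * i \<in> I"
      using I_l_closed[OF i(1) free_algebra_closed(3)] by simp
    then have "scalar c * u \<in> I +>\<^bsub>free_algebra X\<^esub> (scalar c * p)"
      using i by (auto simp: a_r_coset_def' distrib_left)
    then show ?thesis
      using free_algebra_closed(8)[OF free_algebra_closed(3) p]
      by (rule a_repr_independence'[symmetric])
  qed
  have "I +>\<^bsub>free_algebra X\<^esub> p \<noteq> {}"
    using a_rcos_self[OF p] by blast
  moreover have "(\<Union>u\<in>I +>\<^bsub>free_algebra X\<^esub> p. I +>\<^bsub>free_algebra X\<^esub> (scalar c * u)) =
      (\<Union>u\<in>I +>\<^bsub>free_algebra X\<^esub> p. I +>\<^bsub>free_algebra X\<^esub> (scalar c * p))"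
    by (rule SUP_cong[OF refl eq])
  ultimately show ?thesis
    by (simp add: quot_algebra_def)
qed

lemma quot_free_cases:
  assumes "ideal I (free_algebra X)" and "U \<in> carrier (quot_algebra (free_algebra X) I)"
  obtains p where "p \<in> carrier (free_algebra X)" "U = I +>\<^bsub>free_algebra X\<^esub> p"
  using assms(2) by (auto simp: quot_algebra_simps FactRing_def A_RCOSETS_def')

lemma quot_free_ops:
  assumes I: "ideal I (free_algebra X)"
    and p: "p \<in> carrier (free_algebra X)" and r: "r \<in> carrier (free_algebra X)"
  shows "(I +>\<^bsub>free_algebra X\<^esub> p) \<oplus>\<^bsub>quot_algebra (free_algebra X) I\<^esub> (I +>\<^bsub>free_algebra X\<^esub> r)
      = I +>\<^bsub>free_algebra X\<^esub> (p + r)"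
    and "(I +>\<^bsub>free_algebra X\<^esub> p) \<otimes>\<^bsub>quot_algebra (free_algebra X) I\<^esub> (I +>\<^bsub>free_algebra X\<^esub> r)
      = I +>\<^bsub>free_algebra X\<^esub> (p * r)"
    and "I +>\<^bsub>free_algebra X\<^esub> p \<in> carrier (quot_algebra (free_algebra X) I)"
proof -
  interpret ideal I "free_algebra X" by (rule I)
  show "(I +>\<^bsub>free_algebra X\<^esub> p) \<oplus>\<^bsub>quot_algebra (free_algebra X) I\<^esub> (I +>\<^bsub>free_algebra X\<^esub> r)
      = I +>\<^bsub>free_algebra X\<^esub> (p + r)"
    using a_rcos_sum[OF p r] by (simp add: quot_algebra_simps FactRing_def)
  show "(I +>\<^bsub>free_algebra X\<^esub> p) \<otimes>\<^bsub>quot_algebra (free_algebra X) I\<^esub> (I +>\<^bsub>free_algebra X\<^esub> r)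
      = I +>\<^bsub>free_algebra X\<^esub> (p * r)"
    using rcoset_mult_add[OF p r] by (simp add: quot_algebra_simps FactRing_def)
  show "I +>\<^bsub>free_algebra X\<^esub> p \<in> carrier (quot_algebra (free_algebra X) I)"
    using p by (auto simp: quot_algebra_simps FactRing_def A_RCOSETS_def')
qed

lemma vectorspace_quot_free:
  fixes X :: "'x set" and I :: "('x, 'k::field) ncpoly set"
  assumes I: "ideal I (free_algebra X)"
  shows "vectorspace class_ring (quot_algebra (free_algebra X) I)"
proof -
  let ?A = "quot_algebra (free_algebra X) I"
  interpret R: ring ?A by (rule ring_quot_algebra[OF I])
  have "module (class_ring :: 'k ring) ?A"
  proof (rule moduleI)
    show "cring (class_ring :: 'k ring)" ..
    show "abelian_group ?A" ..
  next
    fix a :: 'k and U assume "U \<in> carrier ?A"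
    then show "a \<odot>\<^bsub>?A\<^esub> U \<in> carrier ?A"
      by (elim quot_free_cases[OF I])
        (simp add: quot_free_smult[OF I] quot_free_ops[OF I] free_algebra_closed)
  next
    fix a b :: 'k and U assume "U \<in> carrier ?A"
    then show "(a \<oplus>\<^bsub>class_ring\<^esub> b) \<odot>\<^bsub>?A\<^esub> U = a \<odot>\<^bsub>?A\<^esub> U \<oplus>\<^bsub>?A\<^esub> b \<odot>\<^bsub>?A\<^esub> U"
      by (elim quot_free_cases[OF I])
        (simp add: quot_free_smult[OF I] quot_free_ops[OF I] free_algebra_closed
          scalar_add distrib_right)
  next
    fix a :: 'k and U V assume "U \<in> carrier ?A" "V \<in> carrier ?A"
    then show "a \<odot>\<^bsub>?A\<^esub> (U \<oplus>\<^bsub>?A\<^esub> V) = a \<odot>\<^bsub>?A\<^esub> U \<oplus>\<^bsub>?A\<^esub> a \<odot>\<^bsub>?A\<^esub> V"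
      by (elim quot_free_cases[OF I])
        (simp add: quot_free_smult[OF I] quot_free_ops[OF I] free_algebra_closed distrib_left)
  next
    fix a b :: 'k and U assume "U \<in> carrier ?A"
    then show "(a \<otimes>\<^bsub>class_ring\<^esub> b) \<odot>\<^bsub>?A\<^esub> U = a \<odot>\<^bsub>?A\<^esub> (b \<odot>\<^bsub>?A\<^esub> U)"
      by (elim quot_free_cases[OF I])
        (simp add: quot_free_smult[OF I] free_algebra_closed scalar_mult mult.assoc)
  next
    fix U assume "U \<in> carrier ?A"
    then show "\<one>\<^bsub>class_ring\<^esub> \<odot>\<^bsub>?A\<^esub> U = U"
      by (elim quot_free_cases[OF I]) (simp add: quot_free_smult[OF I] scalar_one)
  qed
  moreover have "field (class_ring :: 'k ring)" ..
  ultimately show ?thesis by (rule vectorspace.intro)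
qed

lemma ring_covering_hecke: "ring (covering_hecke n)"
  unfolding covering_hecke_def by (rule ring_quot_algebra[OF ideal_hecke_ideal])

lemma vectorspace_covering_hecke: "vectorspace class_ring (covering_hecke n)"
  unfolding covering_hecke_def by (rule vectorspace_quot_free[OF ideal_hecke_ideal])

lemma covering_hecke_smult_mult:
  assumes "U \<in> carrier (covering_hecke n)" and "V \<in> carrier (covering_hecke n)"
  shows "c \<odot>\<^bsub>covering_hecke n\<^esub> (U \<otimes>\<^bsub>covering_hecke n\<^esub> V) =
      (c \<odot>\<^bsub>covering_hecke n\<^esub> U) \<otimes>\<^bsub>covering_hecke n\<^esub> V"
    and "c \<odot>\<^bsub>covering_hecke n\<^esub> (U \<otimes>\<^bsub>covering_hecke n\<^esub> V) =
      U \<otimes>\<^bsub>covering_hecke n\<^esub> (c \<odot>\<^bsub>covering_hecke n\<^esub> V)"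
proof -
  note I = ideal_hecke_ideal[of n]
  obtain p r where "p \<in> carrier (hecke_free n)" "U = hecke_ideal n +>\<^bsub>hecke_free n\<^esub> p"
    "r \<in> carrier (hecke_free n)" "V = hecke_ideal n +>\<^bsub>hecke_free n\<^esub> r"
    using assms unfolding covering_hecke_def by (metis quot_free_cases[OF I])
  then show "c \<odot>\<^bsub>covering_hecke n\<^esub> (U \<otimes>\<^bsub>covering_hecke n\<^esub> V) =
      (c \<odot>\<^bsub>covering_hecke n\<^esub> U) \<otimes>\<^bsub>covering_hecke n\<^esub> V"
    and "c \<odot>\<^bsub>covering_hecke n\<^esub> (U \<otimes>\<^bsub>covering_hecke n\<^esub> V) =
      U \<otimes>\<^bsub>covering_hecke n\<^esub> (c \<odot>\<^bsub>covering_hecke n\<^esub> V)"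
    unfolding covering_hecke_def
    by (simp_all add: quot_free_smult[OF I] quot_free_ops[OF I] free_algebra_closed
        mult.assoc scalar_left_commute)
qed

end

theory Submission
  imports Defs "HOL-Library.Function_Algebras"
begin

text \<open>
  Write \<open>H_n\<close> for the covering Hecke algebra. The relations imply that \<open>H_n\<close> is spanned, as a left
  module over the subalgebra generated by \<open>z\<close> and \<open>T_1, ..., T_(n-2)\<close>, by the \<open>n\<close> descending products
  \<open>T_(n-1) T_(n-2) ... T_(n-a)\<close> with \<open>0 \<le> a \<le> n - 1\<close>. Concretely, multiplying such a product on the right by
  a generator gives back a combination of these products with coefficients in the subalgebra
  (\<open>hull_T\<close>). By induction the stated monomials span.

  For independence one has to exhibit a module of dimension \<open>2 n!\<close>. Since \<open>z\<close> is a central involution, it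
  suffices to let \<open>z\<close> act by \<open>s = 1\<close> and by \<open>s = -1\<close>, and to find for both signs a right module in which the
  \<open>n!\<close> ordered monomials send some vector to linearly independent vectors. The module is built by
  recursion on the number of generators. Given a right module \<open>W\<close> for \<open>T_1, ..., T_m\<close>, take formal
  combinations \<open>\<Sum> v_a e_a\<close> with \<open>v_a\<close> in \<open>W\<close> and \<open>0 \<le> a \<le> m + 1\<close>, think of \<open>e_a\<close> as the descending product
  \<open>T_(m+1) ... T_(m+2-a)\<close>, and read off the action of all generators from the spanning computation.
  What needs proof is that this action satisfies the relations.

  The key point is that \<open>T_1, ..., T_m\<close> act in two blocks: on the component at \<open>e_0\<close> as they act on \<open>W\<close>, and
  on the components at \<open>e_1, ..., e_(m+1)\<close> by the same construction one level below, applied to \<open>W\<close> with the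
  generators \<open>s T_1, ..., s T_(m-1)\<close>. Hence they satisfy their relations by induction, and
  only relations involving \<open>T_(m+1)\<close> have to be checked. The square is a short computation
  (\<open>top_act_square\<close>). Commutation up to sign with \<open>T_j\<close> for \<open>j < m\<close> (\<open>top_act_far\<close>) follows from three
  naturality statements: the construction commutes with intertwiners, it respects parity, and
  replacing the symbols \<open>e_a\<close> by the products they stand for is a homomorphism. The braid relation with \<open>T_m\<close>
  is an identity between explicit formulas for the components (\<open>top_act_braid\<close>).

  Starting from the one-dimensional module without generators, the monomial with exponents \<open>a_1, ..., a_m\<close>
  takes the starting vector to the basis vector indexed by \<open>[a_m, ..., a_1]\<close>
  (\<open>ordered_act_vacuum\<close>), which gives independence for each sign.
\<close>

section \<open>Extending a module by one generator\<close>

text \<open>Operators stand for right multiplications, so a word acts by its letters from left to right: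
  \<open>desc t i a x\<close> is \<open>x T_i T_(i-1) ... T_(i-a+1)\<close>.\<close>

primrec desc :: "(nat \<Rightarrow> 'w \<Rightarrow> 'w) \<Rightarrow> nat \<Rightarrow> nat \<Rightarrow> 'w \<Rightarrow> 'w" where
  "desc t i 0 x = x"
| "desc t i (Suc a) x = t (i - a) (desc t i a x)"

lemma desc_Suc_left: "desc t i (Suc a) x = desc t (i - 1) a (t i x)"
  by (induction a) simp_all

text \<open>The central element \<open>z\<close> acts by a scalar \<open>s\<close> with \<open>s^2 = 1\<close>. The parameters \<open>k\<close> (the value of
  \<open>T_i^2\<close>) and \<open>e\<close> (the coefficient in the braid relation) stay independent of each other until the action
  is specialised.\<close>

locale hecke_scalars = Modules.module scale
  for scale :: "'k::comm_ring_1 \<Rightarrow> 'w::ab_group_add \<Rightarrow> 'w" (infixr \<open>*s\<close> 75) +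
  fixes s k e :: 'k
  assumes ss: "s * s = 1"
begin

abbreviation "lin \<equiv> module_hom scale scale"

text \<open>This is the value, in a module over \<open>T_1, ..., T_(m-1)\<close>, of the formal combination \<open>\<Sum> w_a e_a\<close>, where
  \<open>e_a\<close> stands for \<open>T_(m-1) T_(m-2) ... T_(m-a)\<close>.\<close>

definition collapse :: "nat \<Rightarrow> (nat \<Rightarrow> 'w \<Rightarrow> 'w) \<Rightarrow> (nat \<Rightarrow> 'w) \<Rightarrow> 'w" where
  "collapse m t w = (\<Sum>a<m. desc t (m - 1) a (w a))"

text \<open>Let \<open>W\<close> carry \<open>T_1, ..., T_m\<close>. The extended module consists of the combinations
  \<open>\<Sum> v_a e_a\<close> with \<open>v_a\<close> in \<open>W\<close> and \<open>a \<le> m + 1\<close>, where \<open>e_a\<close> stands for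
  \<open>T_(m+1) T_m ... T_(m+2-a)\<close>. The formula for right multiplication by the new generator \<open>T_(m+1)\<close> is what
  the relations force: \<open>e_0\<close> goes to \<open>e_1\<close>, \<open>e_1\<close> to \<open>k e_0\<close>, and in
  \<open>e_(a+2) T_(m+1) = T_(m+1) T_m (T_(m-1) ... T_(m-a)) T_(m+1)\<close> the last letter is moved left past \<open>a\<close>
  letters, at the price of \<open>s^a\<close>, and then the braid relation is applied. Its three terms are the
  diagonal term \<open>s^a T_m e_(a+2)\<close> and the two sums.\<close>

definition top_act :: "nat \<Rightarrow> (nat \<Rightarrow> 'w \<Rightarrow> 'w) \<Rightarrow> (nat \<Rightarrow> 'w) \<Rightarrow> (nat \<Rightarrow> 'w)" where
  "top_act m t v =
     case_nat (k *s v 1 + e *s collapse m t (\<lambda>a. s^a *s t m (v (a + 2))))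
    (case_nat (v 0 - e *s collapse m t (\<lambda>a. v (a + 2)))
      (\<lambda>a. s^a *s t m (v (a + 2))))"

text \<open>Moving \<open>T_(m+1)\<close> past an odd element multiplies it by \<open>s\<close>, so what acts on the components behind
  \<open>T_(m+1)\<close> are the generators \<open>s T_i\<close>.\<close>

abbreviation twist :: "(nat \<Rightarrow> 'w \<Rightarrow> 'w) \<Rightarrow> nat \<Rightarrow> 'w \<Rightarrow> 'w" where
  "twist t \<equiv> \<lambda>i x. s *s t i x"

text \<open>The old generators multiply the component at \<open>e_0\<close> directly; on the components at
  \<open>e_(a+1) = T_(m+1) (T_m ... T_(m+1-a))\<close> they act as on the extended module one level below, with the
  twisted generators as coefficients. Hence the relations among the old generators are inherited.
  The identity at level 0 for indices other than 1 only keeps all operators linear.\<close>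

primrec act :: "nat \<Rightarrow> (nat \<Rightarrow> 'w \<Rightarrow> 'w) \<Rightarrow> nat \<Rightarrow> (nat \<Rightarrow> 'w) \<Rightarrow> (nat \<Rightarrow> 'w)" where
  "act 0 t j v = (if j = 1 then top_act 0 t v else v)"
| "act (Suc m) t j v = (if j = m + 2 then top_act (Suc m) t v
     else case_nat (t j (v 0)) (act m (twist t) j (\<lambda>a. v (Suc a))))"

lemma top_act_simps:
  "top_act m t v 0 = k *s v 1 + e *s collapse m t (\<lambda>a. s^a *s t m (v (a + 2)))"
  "top_act m t v 1 = v 0 - e *s collapse m t (\<lambda>a. v (a + 2))"
  "top_act m t v (a + 2) = s^a *s t m (v (a + 2))"
  by (simp_all add: top_act_def)

lemma act_top: "act m t (Suc m) v = top_act m t v"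
  by (cases m) simp_all

text \<open>The relations are only required of the operators on a subspace \<open>U\<close>. The bound \<open>r\<close> turns the
  functions on all of \<open>nat\<close> into rows of length \<open>r\<close>.\<close>

definition seqs :: "'w set \<Rightarrow> nat \<Rightarrow> (nat \<Rightarrow> 'w) set" where
  "seqs U r = {v. (\<forall>a. v a \<in> U) \<and> (\<forall>a. r \<le> a \<longrightarrow> v a = 0)}"

lemma s_left: "s * (s * c) = c"
  by (simp add: ss mult.assoc[symmetric])

lemma s_pow: "s ^ a * s ^ a = 1"
  by (simp add: ss power_mult_distrib[symmetric])

lemma s_pow_left: "s ^ a * (s ^ a * c) = c"
  by (simp add: s_pow mult.assoc[symmetric])

lemmas s_simps = ss s_left s_pow s_pow_left

lemma s_pow_twice_scale: "s ^ a *s s ^ a *s x = x"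
  by (simp add: ss power_mult_distrib[symmetric])

lemma ss_scale: "s *s s *s x = x"
  by (simp add: ss)

lemma lin_twist: "lin f \<Longrightarrow> lin (\<lambda>x. c *s f x)"
  by (auto simp: module_hom_iff scale_right_distrib mult.commute)

lemma lin_desc:
  assumes "\<And>i. lin (t i)" shows "lin (desc t i a)"
proof (induction a)
  case 0
  then show ?case by (auto simp: module_hom_iff module_axioms)
next
  case (Suc a)
  then show ?case using assms[of "i - a"] by (simp add: module_hom_iff)
qed

lemma desc_twist:
  assumes "\<And>i. lin (t i)" shows "desc (twist t) i a x = s^a *s desc t i a x"
  by (induction a) (simp_all add: module_hom.scale[OF assms] ac_simps)

lemma collapse_add:
  assumes "\<And>i. lin (t i)"
  shows "collapse m t (\<lambda>a. v a + w a) = collapse m t v + collapse m t w"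
  by (simp add: collapse_def module_hom.add[OF lin_desc[OF assms]] sum.distrib)

lemma collapse_scale:
  assumes "\<And>i. lin (t i)"
  shows "collapse m t (\<lambda>a. c *s v a) = c *s collapse m t v"
  by (simp add: collapse_def module_hom.scale[OF lin_desc[OF assms]] scale_sum_right)

lemma collapse_Suc_left: "collapse (Suc m) t v = v 0 + collapse m t (\<lambda>a. t m (v (Suc a)))"
  unfolding collapse_def sum.lessThan_Suc_shift by (simp add: desc_Suc_left del: desc.simps(2))

lemma top_act_add:
  assumes "\<And>i. lin (t i)"
  shows "top_act m t (\<lambda>a. v a + w a) b = top_act m t v b + top_act m t w b"
  by (simp add: top_act_def module_hom.add[OF assms] collapse_add[OF assms] scale_right_distrib
      algebra_simps split: nat.split)

lemma top_act_scale:
  assumes "\<And>i. lin (t i)"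
  shows "top_act m t (\<lambda>a. c *s v a) b = c *s top_act m t v b"
proof -
  have "collapse m t (\<lambda>a. s ^ a *s t m (c *s v (a + 2)))
      = c *s collapse m t (\<lambda>a. s ^ a *s t m (v (a + 2)))"
    by (simp only: module_hom.scale[OF assms] scale_left_commute[of _ c] collapse_scale[OF assms])
  then show ?thesis
    by (simp add: top_act_def module_hom.scale[OF assms] collapse_scale[OF assms]
        scale_right_distrib scale_right_diff_distrib mult.commute split: nat.split)
qed

lemma act_add:
  assumes "\<And>i. lin (t i)"
  shows "act m t j (\<lambda>a. v a + w a) b = act m t j v b + act m t j w b"
  using assms
proof (induction m arbitrary: t v w b)
  case (Suc m)
  have "lin (twist t i)" for i using Suc.prems lin_twist by blast
  from Suc.IH[OF this] show ?case
    by (simp add: module_hom.add[OF Suc.prems] top_act_add[OF Suc.prems] split: nat.split)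
qed (simp add: top_act_add)

lemma act_scale:
  assumes "\<And>i. lin (t i)"
  shows "act m t j (\<lambda>a. c *s v a) b = c *s act m t j v b"
  using assms
proof (induction m arbitrary: t v b)
  case (Suc m)
  have "lin (twist t i)" for i using Suc.prems lin_twist by blast
  from Suc.IH[OF this] show ?case
    by (simp add: module_hom.scale[OF Suc.prems] top_act_scale[OF Suc.prems] split: nat.split)
qed (simp add: top_act_scale)

section \<open>Intertwiners and the parity twist\<close>

lemma collapse_intertwine:
  assumes "subspace U" and f: "lin f" and "\<And>i x. 1 \<le> i \<Longrightarrow> i < m \<Longrightarrow> x \<in> U \<Longrightarrow> t i x \<in> U"
    and "\<And>i x. 1 \<le> i \<Longrightarrow> i < m \<Longrightarrow> x \<in> U \<Longrightarrow> f (t i x) = t' i (f x)"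
    and "\<And>a. v a \<in> U"
  shows "f (collapse m t v) = collapse m t' (\<lambda>a. f (v a))"
proof -
  have "desc t (m - 1) a x \<in> U \<and> f (desc t (m - 1) a x) = desc t' (m - 1) a (f x)"
    if "x \<in> U" "a < m" for x a
    using that(2) by (induction a) (use assms that(1) in simp_all)
  then show ?thesis
    using assms(5) by (simp add: collapse_def module_hom.sum[OF f])
qed

lemma top_act_intertwine:
  assumes "subspace U" and f: "lin f" and "\<And>i x. 1 \<le> i \<Longrightarrow> i \<le> m \<Longrightarrow> x \<in> U \<Longrightarrow> t i x \<in> U"
    and "\<And>i x. 1 \<le> i \<Longrightarrow> i \<le> m \<Longrightarrow> x \<in> U \<Longrightarrow> f (t i x) = t' i (f x)"
    and lin: "\<And>i. lin (t i)" "\<And>i. lin (t' i)"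
    and v: "v \<in> seqs U (m + 2)"
  shows "f (top_act m t v b) = top_act m t' (\<lambda>a. f (v a)) b"
proof -
  have vU: "v a \<in> U" for a using v by (simp add: seqs_def)
  have z: "t m (v (a + 2)) \<in> U \<and> f (t m (v (a + 2))) = t' m (f (v (a + 2)))" for a
  proof (cases "m = 0")
    case True
    then have "v (a + 2) = 0" using v by (simp add: seqs_def)
    then show ?thesis
      using assms(1) by (simp add: module_hom.zero[OF f] module_hom.zero[OF lin(1)] module_hom.zero[OF lin(2)] subspace_0)
  next
    case False
    then show ?thesis using assms(3)[of m "v (a + 2)"] assms(4)[of m "v (a + 2)"] vU by simp
  qed
  then have zz: "s^a *s t m (v (a + 2)) \<in> U" for a using assms(1) subspace_scale by blast
  note c = collapse_intertwine[where U = U and f = f and m = m and t = t and t' = t', OF assms(1) f]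
  have c1: "f (collapse m t (\<lambda>a. s^a *s t m (v (a + 2)))) = collapse m t' (\<lambda>a. f (s^a *s t m (v (a + 2))))"
    by (rule c) (use assms zz in auto)
  have c2: "f (collapse m t (\<lambda>a. v (a + 2))) = collapse m t' (\<lambda>a. f (v (a + 2)))"
    by (rule c) (use assms vU in auto)
  show ?thesis
    using c1 c2 z by (simp add: top_act_def module_hom.scale[OF f] module_hom.add[OF f] module_hom.diff[OF f]
       split: nat.split)
qed

text \<open>The matrix entries of \<open>act\<close> are words in the given operators, so anything that intertwines those
  operators intertwines the extended ones componentwise.\<close>

lemma act_intertwine:
  assumes "subspace U" and f: "lin f" and "\<And>i x. 1 \<le> i \<Longrightarrow> i \<le> m \<Longrightarrow> x \<in> U \<Longrightarrow> t i x \<in> U"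
    and "\<And>i x. 1 \<le> i \<Longrightarrow> i \<le> m \<Longrightarrow> x \<in> U \<Longrightarrow> f (t i x) = t' i (f x)"
    and lin: "\<And>i. lin (t i)" "\<And>i. lin (t' i)"
    and v: "v \<in> seqs U (m + 2)" and j: "1 \<le> j" "j \<le> m + 1"
  shows "f (act m t j v b) = act m t' j (\<lambda>a. f (v a)) b"
  using assms(3-)
proof (induction m arbitrary: t t' v b)
  case 0
  then show ?case using top_act_intertwine[OF assms(1) f, of 0 t t' v b] by simp
next
  case (Suc m)
  show ?case
  proof (cases "j = m + 2")
    case True
    then show ?thesis using top_act_intertwine[OF assms(1) f, of "Suc m" t t' v b] Suc.prems by simp
  next
    case False
    have "f (act m (twist t) j (\<lambda>a. v (Suc a)) b') = act m (twist t') j (\<lambda>a. f (v (Suc a))) b'" for b'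
    proof (rule Suc.IH)
      show "(\<lambda>a. v (Suc a)) \<in> seqs U (m + 2)" using Suc.prems(5) by (simp add: seqs_def)
    qed (use Suc.prems False assms(1) in \<open>auto simp: lin_twist subspace_scale module_hom.scale[OF f]\<close>)
    then show ?thesis using Suc.prems False by (auto simp: seqs_def split: nat.split)
  qed
qed

lemma collapse_parity:
  assumes "\<And>i. lin (t i)"
  shows "collapse m (twist t) (\<lambda>a. s^a *s v a) = collapse m t v"
  by (simp only: collapse_def desc_twist[OF assms] module_hom.scale[OF lin_desc[OF assms]] s_pow_twice_scale)

lemma s_add2: "s ^ (a + 2) = s ^ a"
  by (simp add: s_left)

lemma top_act_parity:
  assumes lin: "\<And>i. lin (t i)"
  shows "top_act m (twist t) (\<lambda>a. s^a *s v a) b = s *s s^b *s top_act m t v b"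
proof -
  have 1: "collapse m (twist t) (\<lambda>a. s^a *s v (a + 2)) = collapse m t (\<lambda>a. v (a + 2))"
    by (rule collapse_parity[OF lin])
  have "collapse m (twist t) (\<lambda>a. s^a *s s *s t m (s^a *s v (a + 2)))
     = s *s collapse m t (\<lambda>a. s^a *s t m (v (a + 2)))"
    by (simp only: collapse_parity[OF lin] collapse_scale[OF lin] module_hom.scale[OF lin])
  then show ?thesis
    unfolding top_act_def s_add2 1
    by (auto simp: module_hom.scale[OF lin] scale_right_distrib scale_right_diff_distrib s_simps ac_simps split: nat.split)
qed

text \<open>The matrix entry of \<open>act m t j\<close> from \<open>e_a\<close> to \<open>e_b\<close> is a combination of words of length congruent
  to \<open>1 + a + b\<close> modulo 2. Twisting the operators therefore multiplies it by \<open>s^(1+a+b)\<close>, that is,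
  conjugates by the diagonal matrix of the \<open>s^a\<close> up to one factor \<open>s\<close>.\<close>

lemma act_parity:
  assumes lin: "\<And>i. lin (t i)" and j: "1 \<le> j" "j \<le> m + 1"
  shows "act m (twist t) j (\<lambda>a. s^a *s v a) b = s *s s^b *s act m t j v b"
  using assms
proof (induction m arbitrary: t v b)
  case 0
  then show ?case using top_act_parity[OF 0(1)] by simp
next
  case (Suc m)
  have lt: "lin (twist t i)" for i using Suc.prems lin_twist by blast
  show ?case
  proof (cases "j = m + 2")
    case True
    then show ?thesis using top_act_parity[OF Suc.prems(1)] by simp
  next
    case False
    have IH: "act m (twist (twist t)) j (\<lambda>a. s^a *s v (Suc a)) b' = s *s s^b' *s act m (twist t) j (\<lambda>a. v (Suc a)) b'" for b'
      by (rule Suc.IH) (use Suc.prems False lt in auto)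
    have "act m (twist (twist t)) j (\<lambda>a. s^Suc a *s v (Suc a)) b' = s^b' *s act m (twist t) j (\<lambda>a. v (Suc a)) b'" for b'
      using act_scale[of "twist (twist t)" m j s "\<lambda>a. s^a *s v (Suc a)" b', OF lin_twist, OF lt] IH[of b'] by (simp add: s_simps)
    then show ?thesis using False by (simp add: s_simps module_hom.scale[OF Suc.prems(1)] split: nat.split)
  qed
qed

section \<open>The relations on the extended module\<close>

text \<open>The relations concern the indices \<open>1, ..., m\<close>. Linearity is demanded for every index, so that it can be
  used without side conditions.\<close>

definition hecke_rep :: "'w set \<Rightarrow> nat \<Rightarrow> (nat \<Rightarrow> 'w \<Rightarrow> 'w) \<Rightarrow> bool" where
  "hecke_rep U m t \<longleftrightarrow> subspace U \<and> (\<forall>i. lin (t i))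
    \<and> (\<forall>i\<in>{1..m}. \<forall>x\<in>U. t i x \<in> U)
    \<and> (\<forall>i\<in>{1..m}. \<forall>x\<in>U. t i (t i x) = k *s x)
    \<and> (\<forall>i\<in>{1..m}. \<forall>j\<in>{1..m}. \<forall>x\<in>U. i + 1 < j \<longrightarrow> t i (t j x) = s *s t j (t i x))
    \<and> (\<forall>i\<in>{1..m}. \<forall>x\<in>U. i + 1 \<le> m \<longrightarrow>
        t i (t (i + 1) (t i x)) = t (i + 1) (t i (t (i + 1) x)) + e *s (t (i + 1) x - t i x))"

lemma hecke_repD:
  assumes "hecke_rep U m t"
  shows "subspace U" and "lin (t i)"
    and "1 \<le> i \<Longrightarrow> i \<le> m \<Longrightarrow> x \<in> U \<Longrightarrow> t i x \<in> U"
    and "1 \<le> i \<Longrightarrow> i \<le> m \<Longrightarrow> x \<in> U \<Longrightarrow> t i (t i x) = k *s x"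
    and "1 \<le> i \<Longrightarrow> i + 1 < j \<Longrightarrow> j \<le> m \<Longrightarrow> x \<in> U \<Longrightarrow> t i (t j x) = s *s t j (t i x)"
    and "1 \<le> i \<Longrightarrow> i + 1 < j \<Longrightarrow> j \<le> m \<Longrightarrow> x \<in> U \<Longrightarrow> t j (t i x) = s *s t i (t j x)"
    and "1 \<le> i \<Longrightarrow> i + 1 \<le> m \<Longrightarrow> x \<in> U \<Longrightarrow>
        t i (t (i + 1) (t i x)) = t (i + 1) (t i (t (i + 1) x)) + e *s (t (i + 1) x - t i x)"
  using assms ss_scale unfolding hecke_rep_def by (simp_all del: scale_scale)

lemma hecke_rep_mono:
  assumes "hecke_rep U m t" "l \<le> m" shows "hecke_rep U l t"
  using assms unfolding hecke_rep_def by auto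

text \<open>Each relation is homogeneous in the parity of its words, so rescaling all generators by \<open>s\<close>
  preserves it.\<close>

lemma hecke_rep_twist:
  assumes "hecke_rep U m t" shows "hecke_rep U m (twist t)"
proof -
  note h = hecke_repD[OF assms]
  note lin = module_hom.scale[OF h(2)]
  show ?thesis
    unfolding hecke_rep_def
  proof (intro conjI ballI allI impI)
    show "subspace U" by (rule h(1))
    show "lin (twist t i)" for i by (rule lin_twist[OF h(2)])
    fix i x assume i: "i \<in> {1..m}" and x: "x \<in> U"
    then show "s *s t i x \<in> U" using h(1) h(3)[of i x] by (simp add: subspace_scale)
    show "s *s t i (s *s t i x) = k *s x" using i x h(4)[of i x] by (simp add: lin s_simps)
    show "s *s t i (s *s t j x) = s *s s *s t j (s *s t i x)" if "j \<in> {1..m}" "i + 1 < j" for j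
      using i x that h(5)[of i j x] by (simp add: lin)
    show "s *s t i (s *s t (i + 1) (s *s t i x))
        = s *s t (i + 1) (s *s t i (s *s t (i + 1) x)) + e *s (s *s t (i + 1) x - s *s t i x)"
      if "i + 1 \<le> m"
    proof -
      have "s *s t i (t (i + 1) (t i x)) = s *s (t (i + 1) (t i (t (i + 1) x)) + e *s (t (i + 1) x - t i x))"
        using i x that h(7)[of i x] by simp
      then show ?thesis
        by (simp add: lin s_simps scale_right_distrib scale_right_diff_distrib mult.commute)
    qed
  qed
qed

lemma desc_closed:
  assumes "hecke_rep U m t" "x \<in> U" "i \<le> m" "a \<le> i" shows "desc t i a x \<in> U"
  using assms(4) by (induction a) (use assms hecke_repD(3)[OF assms(1)] in auto)

lemma desc_far:
  assumes "hecke_rep U m t" "x \<in> U" "i + 1 < j" "j \<le> m" "a \<le> i"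
  shows "t j (desc t i a x) = s^a *s desc t i a (t j x)"
  using assms(5)
proof (induction a)
  case (Suc a)
  note h = hecke_repD[OF assms(1)]
  have d: "desc t i a x \<in> U" using assms Suc.prems by (intro desc_closed[OF assms(1)]) auto
  then have "t j (t (i - a) (desc t i a x)) = s *s t (i - a) (t j (desc t i a x))"
    using assms Suc.prems by (intro h(6)) auto
  then show ?case using Suc by (simp add: module_hom.scale[OF h(2)])
qed simp

text \<open>Expanding both sides leaves, under the sum, exactly the braid relation of \<open>T_m\<close> and \<open>T_(m+1)\<close>.\<close>

lemma collapse_act_top:
  assumes rep: "hecke_rep U (Suc m) t" and v: "v \<in> seqs U (m + 2)"
  shows "collapse (m + 2) t (top_act m t v) = t (Suc m) (collapse (m + 2) t v)"
proof -
  note h = hecke_repD[OF rep]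
  note lin = module_hom.add[OF h(2)] module_hom.scale[OF h(2)] module_hom.diff[OF h(2)]
    module_hom.sum[OF h(2)]
  have U: "v a \<in> U" for a using v by (simp add: seqs_def)
  let ?d = "desc t (m - 1)" and ?p = "t m" and ?r = "t (Suc m)"
  have split: "collapse (m + 2) t w = w 0 + ?r (w 1) + (\<Sum>a<m. ?d a (?p (?r (w (a + 2)))))" for w
    unfolding numeral_2_eq_2 add_Suc_right add_0_right collapse_Suc_left
    by (simp add: collapse_def)
  have d: "?r (?d a x) = s^a *s ?d a (?r x)" if "a < m" "x \<in> U" for a x
    using that by (intro desc_far[OF rep]) auto
  have br: "?p (?r (?p x)) = ?r (?p (?r x)) + e *s (?r x - ?p x)" if "x \<in> U" "m \<noteq> 0" for x
    using h(7)[of m x] that by simp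
  have dl: "?d a (x + y) = ?d a x + ?d a y" "?d a (x - y) = ?d a x - ?d a y" "?d a (c *s x) = c *s ?d a x" for a c x y
    using lin_desc[of t "m - 1" a, OF h(2)] by (simp_all add: module_hom.add module_hom.scale module_hom.diff)
  have "(\<Sum>a<m. ?d a (?p (?r (s^a *s ?p (v (a + 2))))))
    = (\<Sum>a<m. ?r (?d a (?p (?r (v (a + 2)))))) + e *s (\<Sum>a<m. ?r (?d a (v (a+2)))) - e *s (\<Sum>a<m. s^a *s ?d a (?p (v (a+2))))"
    unfolding scale_sum_right sum.distrib[symmetric] sum_subtractf[symmetric]
  proof (rule sum.cong)
    fix a assume a: "a \<in> {..<m}"
    then have "?p (?r (v (a+2))) \<in> U" using h(3) U by simp
    with a show "?d a (?p (?r (s^a *s ?p (v (a + 2))))) = ?r (?d a (?p (?r (v (a + 2))))) + e *s ?r (?d a (v (a+2))) - e *s s^a *s ?d a (?p (v (a+2)))"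
      by (simp add: lin br U d dl scale_right_distrib scale_right_diff_distrib mult.commute algebra_simps del: One_nat_def)
  qed simp
  moreover have "?r (?r (v 1)) = k *s v 1" by (rule h(4)) (auto simp: U)
  ultimately show ?thesis
    unfolding split top_act_simps by (simp add: collapse_def lin dl del: One_nat_def)
qed

text \<open>If \<open>W\<close> already carries \<open>T_(m+1)\<close>, substituting the actual products for the formal symbols \<open>e_a\<close> is a
  homomorphism from the extended module to \<open>W\<close>. This is what makes the sums in \<open>top_act\<close>
  compatible with the generators of lower index. For \<open>j \<le> m\<close> the operator \<open>T_(m+1)\<close> intertwines the
  twisted generators of index below \<open>m\<close> with the untwisted ones, which reduces the claim to the level below.\<close>

lemma collapse_act:
  assumes rep: "hecke_rep U (Suc m) t" and v: "v \<in> seqs U (m + 2)" and j: "1 \<le> j" "j \<le> m + 1"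
  shows "collapse (m + 2) t (act m t j v) = t j (collapse (m + 2) t v)"
  using assms
proof (induction m arbitrary: v)
  case 0
  then show ?case using collapse_act_top[OF 0(1,2)] by simp
next
  case (Suc m)
  show ?case
  proof (cases "j = m + 2")
    case True
    then show ?thesis using collapse_act_top[OF Suc.prems(1,2)] by simp
  next
    case False
    note h = hecke_repD[OF Suc.prems(1)]
    let ?r = "t (m + 2)"
    let ?w = "\<lambda>a. v (Suc a)"
    have w: "?w \<in> seqs U (m + 2)" using Suc.prems(2) by (simp add: seqs_def)
    have sw: "?r (twist t i x) = t i (?r x)" if "1 \<le> i" "i \<le> m" "x \<in> U" for i x
      using h(6)[of i "m + 2" x] that by (simp add: module_hom.scale[OF h(2)] s_simps)
    have cl: "twist t i x \<in> U" if "1 \<le> i" "i \<le> m" "x \<in> U" for i x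
      using h(3)[of i x] that subspace_scale[OF h(1)] by simp
    have "?r (act m (twist t) j ?w b) = act m t j (\<lambda>a. ?r (?w a)) b" for b
    proof (rule act_intertwine[where U = U])
      show "lin (twist t i)" for i using h(2) by (rule lin_twist)
    qed (use h(1,2) cl sw w Suc.prems(3,4) False in simp_all)
    moreover have "collapse (m + 2) t (act m t j (\<lambda>a. ?r (?w a))) = t j (collapse (m + 2) t (\<lambda>a. ?r (?w a)))"
    proof (rule Suc.IH)
      show "(\<lambda>a. ?r (?w a)) \<in> seqs U (m + 2)"
        using w h(3)[of "m+2"] by (auto simp: seqs_def module_hom.zero[OF h(2)])
    qed (use Suc.prems(3,4) False hecke_rep_mono[OF Suc.prems(1), of "Suc m"] in simp_all)
    ultimately show ?thesis
      using False collapse_Suc_left[of "m + 2" t "act (Suc m) t j v"] collapse_Suc_left[of "m + 2" t v]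
      by (simp add: module_hom.add[OF h(2)])
  qed
qed

lemma twist_twist: "twist (twist t) = t"
  by (simp add: s_simps)

lemma act_closed:
  assumes rep: "hecke_rep U m t" and v: "v \<in> seqs U (m + 2)" and j: "1 \<le> j" "j \<le> m + 1"
  shows "act m t j v \<in> seqs U (m + 2)"
proof -
  have top: "top_act m t v \<in> seqs U (m + 2)" if rep: "hecke_rep U m t" and v: "v \<in> seqs U (m + 2)" for m t v
  proof -
    note h = hecke_repD[OF rep]
    have U: "v a \<in> U" for a using v by (simp add: seqs_def)
    have tU: "t m (v (a + 2)) \<in> U" for a
    proof (cases "m = 0")
      case True
      then have "v (a + 2) = 0" using v by (simp add: seqs_def)
      then show ?thesis using h(1) by (simp add: module_hom.zero[OF h(2)] subspace_0)
    qed (use h(3) U in auto)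
    have cU: "collapse m t w \<in> U" if "\<And>a. w a \<in> U" for w
      unfolding collapse_def using that
      by (intro subspace_sum[OF h(1)] desc_closed[OF rep]) auto
    have "top_act m t v b \<in> U" for b
      by (auto simp: top_act_def subspace_add[OF h(1)] subspace_diff[OF h(1)] subspace_scale[OF h(1)]
        U cU tU[simplified] split: nat.split)
    moreover have "top_act m t v b = 0" if "m + 2 \<le> b" for b
      using that v by (cases b; cases "b - 1") (auto simp: top_act_def seqs_def module_hom.zero[OF h(2)])
    ultimately show ?thesis by (simp add: seqs_def)
  qed
  show ?thesis using assms
  proof (induction m arbitrary: t v)
    case 0
    then show ?case using top[OF 0(1,2)] by simp
  next
    case (Suc m)
    have "act m (twist t) j (\<lambda>a. v (Suc a)) \<in> seqs U (m + 2)" if "j \<noteq> m + 2"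
      using Suc.prems that hecke_rep_mono[OF hecke_rep_twist[OF Suc.prems(1)], of m]
      by (intro Suc.IH) (auto simp: seqs_def)
    then show ?case
      using top[OF Suc.prems(1,2)] Suc.prems hecke_repD(3)[OF Suc.prems(1)]
      by (auto simp: seqs_def split: nat.split)
  qed
qed

lemma top_act_square:
  assumes rep: "hecke_rep U m t" and v: "v \<in> seqs U (m + 2)"
  shows "top_act m t (top_act m t v) b = k *s v b"
proof -
  note h = hecke_repD[OF rep]
  note lin = module_hom.scale[OF h(2)]
  have sq: "t m (t m (v (a + 2))) = k *s v (a + 2)" for a
  proof (cases "m = 0")
    case True
    then have "v (a + 2) = 0" using v by (simp add: seqs_def)
    then show ?thesis by (simp add: module_hom.zero[OF h(2)])
  qed (use h(4) v in \<open>auto simp: seqs_def\<close>)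
  consider "b = 0" | "b = 1" | a where "b = a + 2"
    by (metis One_nat_def Suc_1 add.commute not0_implies_Suc plus_1_eq_Suc add_2_eq_Suc)
  then show ?thesis
  proof cases
    case 1
    have "s^a *s t m (s^a *s t m (v (a + 2))) = k *s v (a + 2)" for a
      using sq[of a] by (simp add: lin s_simps)
    then show ?thesis
      unfolding 1 top_act_simps
      by (simp add: collapse_scale[OF h(2)] scale_right_diff_distrib mult.commute)
  next
    case 2
    then show ?thesis unfolding 2 top_act_simps by simp
  next
    case 3
    then show ?thesis using sq[of a] unfolding 3 top_act_simps by (simp add: lin s_simps)
  qed
qed

text \<open>Two levels down the two twists cancel.\<close>

lemma act_low:
  assumes "1 \<le> j" "j \<le> m + 1"
  shows "act (m + 2) t j v =
    case_nat (t j (v 0)) (case_nat (s *s t j (v 1)) (act m t j (\<lambda>a. v (a + 2))))"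
  using assms twist_twist[of t] by (simp add: numeral_2_eq_2 del: scale_scale)

text \<open>On the component \<open>e_(a+2)\<close> the new generator multiplies by \<open>s^a T_(m+2)\<close>, which
  commutes with the action of \<open>T_j\<close> up to \<open>s\<close> by \<open>act_intertwine\<close> and \<open>act_parity\<close>; the sums in
  components 0 and 1 are handled by \<open>collapse_act\<close>.\<close>

lemma top_act_far:
  assumes rep: "hecke_rep U (m + 2) t" and v: "v \<in> seqs U (m + 4)" and j: "1 \<le> j" "j \<le> m + 1"
  shows "act (m + 2) t j (top_act (m + 2) t v) b = s *s top_act (m + 2) t (act (m + 2) t j v) b"
proof -
  note h = hecke_repD[OF rep]
  note lin = module_hom.add[OF h(2)] module_hom.scale[OF h(2)] module_hom.diff[OF h(2)]
  let ?r = "t (m + 2)" and ?w = "\<lambda>a. v (a + 2)"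
  let ?u = "act m t j ?w"
  have U: "v a \<in> U" for a using v by (simp add: seqs_def)
  have w: "?w \<in> seqs U (m + 2)" using v by (simp add: seqs_def)
  have w': "(\<lambda>a. s^a *s ?w a) \<in> seqs U (m + 2)"
    using w subspace_scale[OF h(1)] by (simp add: seqs_def)
  have rw: "(\<lambda>a. s^a *s ?r (?w a)) \<in> seqs U (m + 2)"
    using w subspace_scale[OF h(1)] h(3)[of "m + 2"] by (auto simp: seqs_def module_hom.zero[OF h(2)])
  have sw: "?r (twist t i x) = t i (?r x)" if "1 \<le> i" "i \<le> m" "x \<in> U" for i x
    using h(6)[of i "m + 2" x] that by (simp add: lin s_simps)
  have cl: "twist t i x \<in> U" if "1 \<le> i" "i \<le> m" "x \<in> U" for i x
    using h(3)[of i x] that subspace_scale[OF h(1)] by simp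
  have "?r (act m (twist t) j (\<lambda>a. s^a *s ?w a) a) = act m t j (\<lambda>a. ?r (s^a *s ?w a)) a" for a
  proof (rule act_intertwine[where U = U])
    show "lin (twist t i)" for i using h(2) by (rule lin_twist)
  qed (use h(1,2) cl sw w' j in simp_all)
  \<comment> \<open>One \<open>s\<close> comes from the parity twist; this is the sign in the commutation relation.\<close>
  then have tw: "act m t j (\<lambda>a. s^a *s ?r (?w a)) a = s *s s^a *s ?r (?u a)" for a
    unfolding act_parity[OF h(2) j] by (simp add: lin)
  have "hecke_rep U (Suc m) t" using rep by (rule hecke_rep_mono) simp
  note ca = collapse_act[OF this _ j]
  have c: "t j (collapse (m + 2) t ?w) = collapse (m + 2) t ?u"
    using ca[OF w] by simp
  have c': "t j (collapse (m + 2) t (\<lambda>a. s^a *s ?r (?w a)))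
      = s *s collapse (m + 2) t (\<lambda>a. s^a *s ?r (?u a))"
    using ca[OF rw, unfolded tw] collapse_scale[OF h(2), where m = "m + 2" and c = s and v = "\<lambda>a. s^a *s ?r (?u a)"]
    by simp
  consider "b = 0" | "b = 1" | a where "b = a + 2"
    by (metis One_nat_def Suc_1 add.commute not0_implies_Suc plus_1_eq_Suc add_2_eq_Suc)
  then show ?thesis
  proof cases
    case 1
    then show ?thesis
      using c' unfolding 1 top_act_simps act_low[OF j] by (simp add: lin scale_right_distrib s_simps ac_simps)
  next
    case 2
    then show ?thesis
      using c unfolding 2 act_low[OF j] top_act_simps by (simp add: top_act_simps[simplified] lin scale_right_diff_distrib)
  next
    case 3
    then show ?thesis using tw[of a] unfolding 3 act_low[OF j] top_act_simps by (simp add: top_act_simps[simplified])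
  qed
qed

text \<open>Both new operators are given by explicit formulas in the components 0, 1, 2 and \<open>a + 3\<close>, in which
  every sum is a linear functional \<open>C\<close> of one row. Moving \<open>T_(n+1)\<close> through \<open>C\<close> costs \<open>s^a\<close>, and the claim
  becomes a linear identity that follows from the squares and from the braid relation of \<open>T_n\<close> and
  \<open>T_(n+1)\<close> in the coefficients.\<close>

lemma top_act_braid:
  assumes rep: "hecke_rep U (Suc n) t" and v: "v \<in> seqs U (n + 3)"
  defines "T \<equiv> act (Suc n) t (Suc n)" and "R \<equiv> top_act (Suc n) t"
  shows "T (R (T v)) b = R (T (R v)) b + e *s (R v b - T v b)"
proof -
  note h = hecke_repD[OF rep]
  note lin = module_hom.add[OF h(2)] module_hom.scale[OF h(2)] module_hom.diff[OF h(2)]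
  define p where "p = t n"
  define r where "r = t (Suc n)"
  define C where "C = collapse n t"
  have T0: "T v 0 = r (v 0)"
    and T1: "T v 1 = k *s v 2 + (e * s) *s C (\<lambda>a. p (v (a + 3)))"
    and T2: "T v 2 = v 1 - e *s C (\<lambda>a. s^a *s v (a + 3))"
    and T3: "T v (a + 3) = (s * s^a) *s p (v (a + 3))" for v a
  proof -
    let ?w = "\<lambda>a. v (Suc a)"
    have T: "T v = case_nat (r (v 0)) (top_act n (twist t) ?w)"
      by (simp add: T_def r_def act_top)
    have "collapse n (twist t) (\<lambda>a. s^a *s twist t n (?w (a + 2))) = s *s C (\<lambda>a. p (v (a + 3)))"
      by (simp only: collapse_parity[OF h(2)] collapse_scale[OF h(2)] C_def p_def)
        (simp add: numeral_3_eq_3)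
    then show "T v 1 = k *s v 2 + (e * s) *s C (\<lambda>a. p (v (a + 3)))"
      unfolding T by (simp add: top_act_def numeral_2_eq_2)
    have "collapse n (twist t) (\<lambda>a. ?w (a + 2)) = C (\<lambda>a. s^a *s v (a + 3))"
      using collapse_parity[OF h(2), where m = n and v = "\<lambda>a. s^a *s v (a + 3)"]
      by (simp add: s_simps C_def numeral_3_eq_3)
    then show "T v 2 = v 1 - e *s C (\<lambda>a. s^a *s v (a + 3))"
      unfolding T by (simp add: top_act_def numeral_2_eq_2)
    show "T v 0 = r (v 0)" "T v (a + 3) = (s * s^a) *s p (v (a + 3))"
      unfolding T by (simp_all add: top_act_def p_def numeral_3_eq_3 mult.commute)
  qed
  have R0: "R v 0 = k *s v 1 + e *s r (v 2) + (e * s) *s C (\<lambda>a. s^a *s p (r (v (a + 3))))"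
    and R1: "R v 1 = v 0 - e *s v 2 - e *s C (\<lambda>a. p (v (a + 3)))"
    and R2: "R v 2 = r (v 2)"
    and R3: "R v (a + 3) = (s * s^a) *s r (v (a + 3))" for v a
  proof -
    have "C (\<lambda>a. p (s^Suc a *s r (v (Suc a + 2)))) = s *s C (\<lambda>a. s^a *s p (r (v (a + 3))))"
      unfolding C_def collapse_scale[OF h(2), symmetric]
      by (simp add: lin p_def numeral_3_eq_3)
    then show "R v 0 = k *s v 1 + e *s r (v 2) + (e * s) *s C (\<lambda>a. s^a *s p (r (v (a + 3))))"
      unfolding R_def top_act_simps collapse_Suc_left
      by (simp add: C_def p_def r_def scale_right_distrib numeral_2_eq_2)
    show "R v 1 = v 0 - e *s v 2 - e *s C (\<lambda>a. p (v (a + 3)))"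
      unfolding R_def top_act_simps collapse_Suc_left
      by (simp add: C_def p_def scale_right_distrib numeral_2_eq_2 numeral_3_eq_3 diff_diff_add)
    show "R v 2 = r (v 2)" "R v (a + 3) = (s * s^a) *s r (v (a + 3))"
      by (simp_all add: R_def top_act_def r_def numeral_2_eq_2 numeral_3_eq_3)
  qed
  have Cadd: "C (\<lambda>a. f a + g a) = C f + C g" and Cscale: "C (\<lambda>a. c *s f a) = c *s C f"
    and Cdiff: "C (\<lambda>a. f a - g a) = C f - C g" for f g c
    unfolding C_def collapse_add[OF h(2)] collapse_scale[OF h(2)]
    using collapse_add[OF h(2), where m = n and v = "\<lambda>a. f a - g a" and w = g] by (simp_all add: algebra_simps)
  have Cr: "r (C f) = C (\<lambda>a. s^a *s r (f a))" if "\<And>a. f a \<in> U" for f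
    unfolding C_def collapse_def r_def module_hom.sum[OF h(2)]
    using desc_far[OF rep that, of "n - 1" "Suc n"]
    by (intro sum.cong refl) (simp add: module_hom.scale[OF lin_desc[OF h(2)]])
  have U: "v a \<in> U" for a using v by (simp add: seqs_def)
  have rU: "x \<in> U \<Longrightarrow> r x \<in> U" and rr: "x \<in> U \<Longrightarrow> r (r x) = k *s x" for x
    using h(3)[of "Suc n" x] h(4)[of "Suc n" x] by (simp_all add: r_def)
  have sU: "x \<in> U \<Longrightarrow> c *s x \<in> U" for c x using h(1) by (rule subspace_scale)
  note lin' = lin[of n, folded p_def] lin[of "Suc n", folded r_def]
  consider "b = 0" | "b = 1" | "b = 2" | a where "b = a + 3"
    by (metis One_nat_def Suc_1 add.commute not0_implies_Suc plus_1_eq_Suc add_2_eq_Suc numeral_3_eq_3 add_Suc_right add_0_right)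
  note split = this
  \<comment> \<open>For \<open>n = 0\<close> there is no generator \<open>T_n\<close> in the coefficients, but the row \<open>v (a + 3)\<close> is then zero.\<close>
  show ?thesis
  proof (cases "n = 0")
    case True
    then have z: "C f = 0" "v (a + 3) = 0" for f a
      using v by (simp_all add: C_def collapse_def seqs_def)
    have "p 0 = 0" "r 0 = 0"
      by (simp_all add: p_def r_def module_hom.zero[OF h(2)])
    with split show ?thesis
      by cases (simp_all only: T0 T1 T2 T3 R0 R1 R2 R3, simp_all add: z lin' U rr scale_right_diff_distrib scale_right_distrib ac_simps)
  next
    case False
    have pU: "x \<in> U \<Longrightarrow> p x \<in> U" and pp: "x \<in> U \<Longrightarrow> p (p x) = k *s x"
      and prp: "x \<in> U \<Longrightarrow> p (r (p x)) = r (p (r x)) + e *s r x - e *s p x" for x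
      using False h(3)[of n x] h(4)[of n x] h(7)[of n x]
      by (simp_all add: p_def r_def scale_right_diff_distrib)
    \<comment> \<open>Scalars are moved under \<open>C\<close> and sums out of it, so that equal terms of both sides cancel.\<close>
    note simps = lin' Cr U pU rU pp rr sU prp s_simps scale_right_distrib scale_right_diff_distrib
    from split show ?thesis
    proof cases
      case 1
      show ?thesis
        unfolding 1 T0 T1 T2 T3 R0 R1 R2 R3
        by (simp add: simps Cscale[symmetric] Cadd Cdiff ac_simps)
    next
      case 2
      show ?thesis
        unfolding 2 T0 T1 T2 T3 R0 R1 R2 R3
        by (simp add: simps Cscale[symmetric] Cadd Cdiff ac_simps)
    next
      case 3
      show ?thesis
        unfolding 3 T0 T1 T2 T3 R0 R1 R2 R3
        by (simp add: simps Cscale[symmetric] Cadd Cdiff ac_simps)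
    next
      case 4
      show ?thesis
        unfolding 4 T0 T1 T2 T3 R0 R1 R2 R3
        by (simp add: simps ac_simps)
    qed
  qed
qed

lemma seqs_Suc: "v \<in> seqs U (Suc m) \<Longrightarrow> (\<lambda>a. v (Suc a)) \<in> seqs U m"
  by (simp add: seqs_def)

text \<open>In the next three lemmas the top generator has been treated above. The other generators act as
  themselves at \<open>e_0\<close> and through the level below elsewhere, so induction applies.\<close>

lemma act_square:
  assumes "hecke_rep U m t" and "v \<in> seqs U (m + 2)" and "1 \<le> j" "j \<le> m + 1"
  shows "act m t j (act m t j v) b = k *s v b"
  using assms
proof (induction m arbitrary: t v b)
  case 0
  then show ?case using top_act_square[OF 0(1,2)] by simp
next
  case (Suc m)
  note h = hecke_repD[OF Suc.prems(1)]
  show ?case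
  proof (cases "j = m + 2")
    case True
    then show ?thesis using top_act_square[OF Suc.prems(1,2)] by simp
  next
    case False
    have "act m (twist t) j (act m (twist t) j (\<lambda>a. v (Suc a))) b = k *s v (Suc b)" for b
      using Suc.prems False hecke_rep_mono[OF hecke_rep_twist[OF Suc.prems(1)], of m]
      by (intro Suc.IH) (auto intro: seqs_Suc)
    then show ?thesis
      using h(4)[of j "v 0"] Suc.prems False by (simp add: seqs_def split: nat.split)
  qed
qed

lemma act_far:
  assumes "hecke_rep U m t" and "v \<in> seqs U (m + 2)" and "1 \<le> i" "i + 1 < j" "j \<le> m + 1"
  shows "act m t i (act m t j v) b = s *s act m t j (act m t i v) b"
  using assms
proof (induction m arbitrary: t v b)
  case 0
  then show ?case by simp
next
  case (Suc m)
  note h = hecke_repD[OF Suc.prems(1)]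
  show ?case
  proof (cases "j = m + 2")
    case True
    then obtain l where "m = Suc l" using Suc.prems by (cases m) auto
    moreover from this have "v \<in> seqs U (l + 4)"
      using Suc.prems(2) by (simp add: eval_nat_numeral)
    ultimately show ?thesis
      using top_act_far[of U l t v i b] Suc.prems True by simp
  next
    case False
    have "act m (twist t) i (act m (twist t) j (\<lambda>a. v (Suc a))) b
        = s *s act m (twist t) j (act m (twist t) i (\<lambda>a. v (Suc a))) b" for b
      using Suc.prems False hecke_rep_mono[OF hecke_rep_twist[OF Suc.prems(1)], of m]
      by (intro Suc.IH) (auto intro: seqs_Suc)
    then show ?thesis
      using h(5)[of i j "v 0"] Suc.prems False by (simp add: seqs_def split: nat.split)
  qed
qed

lemma act_braid:
  assumes "hecke_rep U m t" and "v \<in> seqs U (m + 2)" and "1 \<le> i" "i \<le> m"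
  shows "act m t i (act m t (i + 1) (act m t i v)) b = act m t (i + 1) (act m t i (act m t (i + 1) v)) b
    + e *s (act m t (i + 1) v b - act m t i v b)"
  using assms
proof (induction m arbitrary: t v b)
  case 0
  then show ?case by simp
next
  case (Suc m)
  note h = hecke_repD[OF Suc.prems(1)]
  show ?case
  proof (cases "i = m + 1")
    case True
    have "v \<in> seqs U (m + 3)" using Suc.prems(2) by (simp add: numeral_2_eq_2 numeral_3_eq_3)
    then show ?thesis
      using top_act_braid[OF Suc.prems(1), of v b] True by simp
  next
    case False
    have "act m (twist t) i (act m (twist t) (i + 1) (act m (twist t) i (\<lambda>a. v (Suc a)))) b
        = act m (twist t) (i + 1) (act m (twist t) i (act m (twist t) (i + 1) (\<lambda>a. v (Suc a)))) b
         + e *s (act m (twist t) (i + 1) (\<lambda>a. v (Suc a)) b - act m (twist t) i (\<lambda>a. v (Suc a)) b)" for b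
      using Suc.prems False hecke_rep_mono[OF hecke_rep_twist[OF Suc.prems(1)], of m]
      by (intro Suc.IH) (auto intro: seqs_Suc)
    then show ?thesis
      using h(7)[of i "v 0"] Suc.prems False by (simp add: seqs_def split: nat.split)
  qed
qed

end

section \<open>A module with basis the exponent sequences\<close>

abbreviation fscale :: "'k::comm_ring_1 \<Rightarrow> ('a \<Rightarrow> 'k) \<Rightarrow> 'a \<Rightarrow> 'k" where
  "fscale c f \<equiv> (\<lambda>x. c * f x)"

lemma module_fscale: "Modules.module fscale"
  by unfold_locales (auto simp: algebra_simps)

definition delta :: "'a \<Rightarrow> 'a \<Rightarrow> 'k::comm_ring_1" where
  "delta x y = (if y = x then 1 else 0)"

text \<open>A function on lists is the row of its slices by the head of the list. Iterating the extension
  then stays within one type; the empty list itself belongs to level 0, hence the value 0.\<close>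

definition glue :: "(nat \<Rightarrow> nat list \<Rightarrow> 'k) \<Rightarrow> nat list \<Rightarrow> 'k::comm_ring_1" where
  "glue v = case_list 0 v"

abbreviation slice :: "(nat list \<Rightarrow> 'k) \<Rightarrow> nat \<Rightarrow> nat list \<Rightarrow> 'k::comm_ring_1" where
  "slice f \<equiv> \<lambda>a l. f (a # l)"

text \<open>The element \<open>x e_a\<close> of the extended module.\<close>

definition put :: "nat \<Rightarrow> (nat list \<Rightarrow> 'k) \<Rightarrow> nat list \<Rightarrow> 'k::comm_ring_1" where
  "put a x = glue (\<lambda>b. if b = a then x else 0)"

lemma slice_put: "slice (put a x) = (\<lambda>b. if b = a then x else 0)"
  by (auto simp: put_def glue_def)

lemma put_Nil: "put a x [] = 0"
  by (simp add: put_def glue_def)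

lemma put_delta: "put a (delta l) = delta (a # l)"
  by (auto simp: put_def glue_def delta_def fun_eq_iff split: list.split)

lemma slice_glue [simp]: "slice (glue v) = v"
  by (simp add: glue_def)

lemma glue_slice: "f [] = 0 \<Longrightarrow> glue (slice f) = f"
  by (auto simp: glue_def fun_eq_iff split: list.split)

primrec ordered_act :: "(nat \<Rightarrow> 'w \<Rightarrow> 'w) \<Rightarrow> (nat \<Rightarrow> nat) \<Rightarrow> nat \<Rightarrow> 'w \<Rightarrow> 'w" where
  "ordered_act t a 0 x = x"
| "ordered_act t a (Suc k) x = desc t (Suc k) (a (Suc k)) (ordered_act t a k x)"

text \<open>Each extension prepends the exponent of the newest generator, so the sequence is coded in reverse.\<close>

primrec code :: "(nat \<Rightarrow> nat) \<Rightarrow> nat \<Rightarrow> nat list" where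
  "code a 0 = []"
| "code a (Suc m) = a (Suc m) # code a m"

locale hecke_params =
  fixes s k e :: "'k::comm_ring_1"
  assumes s_square: "s * s = 1"
begin

sublocale hecke_scalars fscale s k e
  using module_fscale s_square by (simp add: hecke_scalars_def hecke_scalars_axioms_def)

text \<open>Iterated extension, starting from the base ring with no generators.\<close>

primrec gen_act :: "nat \<Rightarrow> nat \<Rightarrow> (nat list \<Rightarrow> 'k) \<Rightarrow> nat list \<Rightarrow> 'k" where
  "gen_act 0 = (\<lambda>j f. f)"
| "gen_act (Suc m) = (\<lambda>j f. glue (act m (gen_act m) j (slice f)))"

text \<open>The functions supported on the lists \<open>[a_m, ..., a_1]\<close> with \<open>a_i \<le> i\<close>.\<close>

primrec code_space :: "nat \<Rightarrow> (nat list \<Rightarrow> 'k) set" where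
  "code_space 0 = {f. \<forall>l. l \<noteq> [] \<longrightarrow> f l = 0}"
| "code_space (Suc m) = {f. f [] = 0 \<and> slice f \<in> seqs (code_space m) (m + 2)}"

lemma lin_gen_act: "lin (gen_act m j)"
proof (induction m arbitrary: j)
  case 0
  then show ?case by (simp add: module_hom_iff module_fscale)
next
  case (Suc m)
  have "glue (act m (gen_act m) j (slice (f + g))) = glue (act m (gen_act m) j (slice f)) + glue (act m (gen_act m) j (slice g))" for f g
  proof -
    have 1: "slice (f + g) = (\<lambda>a. slice f a + slice g a)" by (simp add: fun_eq_iff)
    show ?thesis
      unfolding 1 by (simp add: act_add[where t = "gen_act m", OF Suc] fun_eq_iff glue_def split: list.split)
  qed
  moreover have "glue (act m (gen_act m) j (slice (fscale c f))) = fscale c (glue (act m (gen_act m) j (slice f)))" for c f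
      using act_scale[where t = "gen_act m", OF Suc, where j = j and m = m and c = c and v = "slice f"] by (auto simp: glue_def fun_eq_iff split: list.split)
  ultimately show ?case by (simp add: module_hom_iff module_fscale)
qed

lemma subspace_code_space: "subspace (code_space m)"
  by (induction m) (auto simp: subspace_def seqs_def zero_fun_def plus_fun_def fun_eq_iff)

lemma hecke_rep_gen_act: "hecke_rep (code_space m) m (gen_act m)"
proof (induction m)
  case 0
  show ?case using subspace_code_space[of 0] lin_gen_act[of 0] by (simp add: hecke_rep_def)
next
  case (Suc m)
  show ?case unfolding hecke_rep_def
  proof (intro conjI ballI allI impI)
    show "subspace (code_space (Suc m))" by (rule subspace_code_space)
    show "lin (gen_act (Suc m) i)" for i by (rule lin_gen_act)
    fix i f assume "i \<in> {1..Suc m}" and "f \<in> code_space (Suc m)"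
    then have i: "1 \<le> i" "i \<le> m + 1" and v: "slice f \<in> seqs (code_space m) (m + 2)" and f0: "f [] = 0"
      by auto
    show "gen_act (Suc m) i f \<in> code_space (Suc m)"
      using act_closed[OF Suc v i] by simp (simp add: glue_def)
    have f: "f = glue (slice f)" using f0 by (simp add: glue_slice)
    show "gen_act (Suc m) i (gen_act (Suc m) i f) = fscale k f"
    proof -
      have "act m (gen_act m) i (act m (gen_act m) i (slice f)) = slice (fscale k f)"
        using act_square[OF Suc v i] by auto
      moreover have "fscale k f [] = 0" using f0 by simp
      ultimately show ?thesis
        using glue_slice[of "fscale k f"] by (simp only: gen_act.simps slice_glue)
    qed
    show "gen_act (Suc m) i (gen_act (Suc m) j f) = fscale s (gen_act (Suc m) j (gen_act (Suc m) i f))"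
      if "j \<in> {1..Suc m}" "i + 1 < j" for j
      using act_far[OF Suc v i(1) that(2)] that(1)
      by (auto simp: glue_def fun_eq_iff split: list.split)
    show "gen_act (Suc m) i (gen_act (Suc m) (i + 1) (gen_act (Suc m) i f))
       = gen_act (Suc m) (i + 1) (gen_act (Suc m) i (gen_act (Suc m) (i + 1) f)) +
         fscale e (gen_act (Suc m) (i + 1) f - gen_act (Suc m) i f)" if "i + 1 \<le> Suc m"
      using act_braid[OF Suc v i(1)] that
      by (auto simp: glue_def fun_eq_iff split: list.split)
  qed
qed

abbreviation single :: "nat \<Rightarrow> 'w::zero \<Rightarrow> nat \<Rightarrow> 'w" where
  "single a x \<equiv> (\<lambda>b. if b = a then x else 0)"

lemma act_zero:
  assumes "\<And>i. lin (t i)" shows "act m t j (\<lambda>_. 0) b = 0"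
  using act_scale[OF assms, where m = m and j = j and c = 0 and v = "\<lambda>_. 0" and b = b] by (simp add: zero_fun_def)

lemma act_single_low:
  assumes "\<And>i. lin (t i)" and "1 \<le> j" "j \<le> m"
  shows "act m t j (single 0 x) = single 0 (t j x)"
proof -
  obtain l where l: "m = Suc l" using assms by (cases m) auto
  have "lin (twist t i)" for i by (rule lin_twist[OF assms(1)])
  from act_zero[OF this, where m = l and j = j] show ?thesis
    using assms l by (auto simp: fun_eq_iff split: nat.split)
qed

lemma act_single_climb:
  assumes "\<And>i. lin (t i)" and "a \<le> m"
  shows "act m t (Suc m - a) (single a x) = single (Suc a) x"
  using assms
proof (induction a arbitrary: m t)
  case 0
  have c: "collapse m t (\<lambda>a. 0) = 0" 
    using collapse_scale[OF 0(1), where m = m and c = 0 and v = "\<lambda>_. 0"] by (simp add: zero_fun_def)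
  show ?case
    using c by (auto simp: act_top top_act_def fun_eq_iff module_hom.zero[OF 0(1)] zero_fun_def[symmetric] split: nat.split)
next
  case (Suc a)
  then obtain l where l: "m = Suc l" by (cases m) auto
  have "lin (twist t i)" for i by (rule lin_twist[OF Suc.prems(1)])
  from Suc.IH[of "twist t" l, OF this] have "act l (twist t) (Suc l - a) (single a x) = single (Suc a) x"
    using Suc.prems l by simp
  then show ?case
    using Suc.prems l by (auto simp: fun_eq_iff module_hom.zero[OF Suc.prems(1)] split: nat.split)
qed

lemma gen_act_put_low:
  "1 \<le> j \<Longrightarrow> j \<le> m \<Longrightarrow> gen_act (Suc m) j (put 0 x) = put 0 (gen_act m j x)"
  using act_single_low[where t = "gen_act m", OF lin_gen_act, where j = j and m = m and x = x]
  unfolding gen_act.simps slice_put by (simp add: put_def)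

text \<open>The products with which the symbols \<open>e_a\<close> were introduced: \<open>T_(m+1) ... T_(m+2-a)\<close> maps
  \<open>x e_0\<close> to \<open>x e_a\<close> without correction terms.\<close>

lemma gen_act_put_climb:
  "a \<le> m \<Longrightarrow> gen_act (Suc m) (Suc m - a) (put a x) = put (Suc a) x"
  using act_single_climb[where t = "gen_act m", OF lin_gen_act, where a = a and m = m and x = x]
  unfolding gen_act.simps slice_put by (simp add: put_def)

lemma desc_put_low:
  assumes "i \<le> m" "a \<le> i"
  shows "desc (gen_act (Suc m)) i a (put 0 x) = put 0 (desc (gen_act m) i a x)"
  using assms(2)
  by (induction a) (use assms(1) gen_act_put_low in \<open>simp_all del: gen_act.simps\<close>)

lemma desc_put_top:
  assumes "a \<le> Suc m"
  shows "desc (gen_act (Suc m)) (Suc m) a (put 0 x) = put a x"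
  using assms
  by (induction a) (use gen_act_put_climb in \<open>simp_all del: gen_act.simps\<close>)

lemma ordered_act_put:
  assumes "j \<le> m" "\<And>i. i \<in> {1..j} \<Longrightarrow> a i \<le> i"
  shows "ordered_act (gen_act (Suc m)) a j (put 0 x) = put 0 (ordered_act (gen_act m) a j x)"
  using assms
  by (induction j) (simp_all add: desc_put_low del: gen_act.simps desc.simps)

text \<open>The reason for the whole construction: different ordered monomials send the starting vector to
  different basis vectors.\<close>

lemma ordered_act_vacuum:
  assumes "\<And>i. i \<in> {1..m} \<Longrightarrow> a i \<le> i"
  shows "ordered_act (gen_act m) a m (delta (replicate m 0)) = delta (code a m)"
  using assms
proof (induction m)
  case (Suc m)
  have "ordered_act (gen_act (Suc m)) a m (put 0 (delta (replicate m 0)))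
      = put 0 (ordered_act (gen_act m) a m (delta (replicate m 0)))"
    by (rule ordered_act_put) (use Suc.prems in auto)
  also have "ordered_act (gen_act m) a m (delta (replicate m 0)) = delta (code a m)"
    using Suc by simp
  finally have "ordered_act (gen_act (Suc m)) a (Suc m) (put 0 (delta (replicate m 0)))
      = put (a (Suc m)) (delta (code a m))"
    using Suc.prems desc_put_top[of "a (Suc m)" m] by (simp del: gen_act.simps desc.simps)
  then show ?case by (simp add: put_delta del: gen_act.simps ordered_act.simps)
qed simp

lemma vacuum_in_code_space: "delta (replicate m 0) \<in> code_space m"
proof (induction m)
  case (Suc m)
  have "0 \<in> code_space m" using subspace_code_space subspace_0 by blast
  then have "put 0 (delta (replicate m 0)) \<in> code_space (Suc m)"
    using Suc by (simp only: code_space.simps mem_Collect_eq slice_put put_Nil) (simp add: seqs_def)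
  then show ?case by (simp add: put_delta)
qed (simp add: delta_def)

end

lemma code_inject:
  "code a m = code b m \<longleftrightarrow> (\<forall>i\<in>{1..m}. a i = b i)"
proof (induction m)
  case (Suc m)
  have "{1..Suc m} = insert (Suc m) {1..m}" by auto
  then show ?case using Suc by simp
qed simp

section \<open>Letting the free algebra act\<close>

locale word_action = Modules.module scale
  for scale :: "'k::field \<Rightarrow> 'w::ab_group_add \<Rightarrow> 'w" (infixr \<open>*s\<close> 75) +
  fixes A :: "'x \<Rightarrow> 'w \<Rightarrow> 'w"
  assumes lin_A: "module_hom scale scale (A x)"
begin

definition ev :: "('x, 'k) ncpoly \<Rightarrow> 'w \<Rightarrow> 'w" where
  "ev p v = (\<Sum>w\<in>Poly_Mapping.keys p. Poly_Mapping.lookup p w *s fold A (letters w) v)"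

lemma ev_superset:
  "finite S \<Longrightarrow> Poly_Mapping.keys p \<subseteq> S \<Longrightarrow>
    ev p v = (\<Sum>w\<in>S. Poly_Mapping.lookup p w *s fold A (letters w) v)"
  unfolding ev_def by (rule sum.mono_neutral_left) (auto simp: in_keys_iff)

lemma ev_add: "ev (p + q) v = ev p v + ev q v"
proof -
  let ?S = "Poly_Mapping.keys p \<union> Poly_Mapping.keys q"
  have "Poly_Mapping.keys (p + q) \<subseteq> ?S" by (rule Poly_Mapping.keys_add)
  then show ?thesis
    using ev_superset[of ?S p v] ev_superset[of ?S q v] ev_superset[of ?S "p + q" v]
    by (simp add: lookup_add scale_left_distrib sum.distrib)
qed

lemma ev_zero: "ev 0 v = 0"
  by (simp add: ev_def)

lemma ev_uminus: "ev (- p) v = - ev p v"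
  using ev_add[of p "- p" v] by (simp add: ev_zero add_eq_0_iff)

lemma ev_diff: "ev (p - q) v = ev p v - ev q v"
  using ev_add[of p "- q" v] by (simp add: ev_uminus)

lemma ev_single: "ev (Poly_Mapping.single w c) v = c *s fold A (letters w) v"
  by (simp add: ev_def)

lemma ncpoly_induct [case_names single add]:
  assumes "\<And>w c. P (Poly_Mapping.single w c)" and "\<And>p q. P p \<Longrightarrow> P q \<Longrightarrow> P (p + q)"
  shows "P (p :: ('x, 'k) ncpoly)"
proof (induction p rule: update_induct)
  case const
  show ?case using assms(1)[of 0 0] by simp
next
  case (update f a b)
  have "Poly_Mapping.update a b f = f + Poly_Mapping.single a b"
    using update by (intro poly_mapping_eqI)
      (auto simp: lookup_update lookup_add lookup_single in_keys_iff when_def)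
  then show ?case using update assms by metis
qed

lemma lin_fold: "module_hom scale scale (fold A l)"
proof (induction l)
  case Nil
  show ?case by (simp add: module_hom_iff module_axioms)
next
  case (Cons a l)
  then show ?case using lin_A[of a] by (simp add: module_hom_iff)
qed

lemma lin_ev: "module_hom scale scale (ev p)"
proof (induction p rule: ncpoly_induct)
  case (single w c)
  show ?case
    using lin_fold[of "letters w"]
    by (simp add: module_hom_iff ev_single scale_right_distrib mult.commute)
next
  case (add p q)
  then show ?case by (simp add: module_hom_iff ev_add scale_right_distrib)
qed

text \<open>Words act by \<open>fold\<close> from their left end, so this is a right action.\<close>

lemma ev_mult: "ev (p * q) v = ev q (ev p v)"
proof (induction p rule: ncpoly_induct)
  case (single w c)
  show ?case
  proof (induction q rule: ncpoly_induct)
    case (single u d)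
    show ?case
      by (simp add: mult_single ev_single plus_word_def module_hom.scale[OF lin_fold] mult.commute)
  next
    case (add p q)
    then show ?case by (simp add: distrib_left ev_add)
  qed
next
  case (add p q)
  then show ?case by (simp add: distrib_right ev_add module_hom.add[OF lin_ev])
qed

lemma ev_letter: "ev (letter x) v = A x v"
  by (simp add: letter_def ev_single)

lemma ev_scalar: "ev (scalar c) v = c *s v"
  by (simp add: scalar_def ev_single zero_word_def)

lemma ev_one: "ev 1 v = v"
  using ev_scalar[of 1 v] by (simp add: scalar_one)

lemma ev_sum: "ev (sum f S) v = (\<Sum>x\<in>S. ev (f x) v)"
  by (induction S rule: infinite_finite_induct) (simp_all add: ev_zero ev_add)

lemmas ev_simps = ev_zero ev_add ev_diff ev_mult ev_letter ev_scalar ev_one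

lemma ev_closed:
  assumes U: "subspace U" and A: "\<And>x v. x \<in> X \<Longrightarrow> v \<in> U \<Longrightarrow> A x v \<in> U"
    and p: "p \<in> carrier (free_algebra X)" and v: "v \<in> U"
  shows "ev p v \<in> U"
proof -
  have "fold A l v \<in> U" if "set l \<subseteq> X" for l
    using that v by (induction l arbitrary: v) (auto intro: A)
  then show ?thesis
    using free_algebra_carrierD[OF p] unfolding ev_def
    by (intro subspace_sum[OF U] subspace_scale[OF U]) auto
qed

text \<open>The elements that annihilate an invariant subspace form a two-sided ideal, since the action of
  the free algebra preserves the subspace.\<close>

lemma ev_genideal:
  assumes U: "subspace U" and A: "\<And>x v. x \<in> X \<Longrightarrow> v \<in> U \<Longrightarrow> A x v \<in> U"
    and R: "R \<subseteq> carrier (free_algebra X)" and rel: "\<And>r v. r \<in> R \<Longrightarrow> v \<in> U \<Longrightarrow> ev r v = 0"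
    and p: "p \<in> Idl\<^bsub>free_algebra X\<^esub> R" and v: "v \<in> U"
  shows "ev p v = 0"
proof -
  interpret F: ring "free_algebra X" by (rule ring_free_algebra)
  let ?J = "{p \<in> carrier (free_algebra X). \<forall>v\<in>U. ev p v = 0}"
  have neg: "inv\<^bsub>add_monoid (free_algebra X)\<^esub> p = - p" if "p \<in> carrier (free_algebra X)" for p
    using F.minus_equality[of "- p" p] that free_algebra_closed(5)[OF that] by (simp add: a_inv_def)
  have "ideal ?J (free_algebra X)"
  proof (rule idealI)
    show "ring (free_algebra X)" by (rule ring_free_algebra)
    show "subgroup ?J (add_monoid (free_algebra X))"
      by (rule subgroup.intro) (auto simp: free_algebra_closed ev_simps neg[simplified] ev_uminus)
  qed (auto simp: free_algebra_closed ev_simps module_hom.zero[OF lin_ev] ev_closed[OF U A])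
  then have "Idl\<^bsub>free_algebra X\<^esub> R \<subseteq> ?J"
    using R rel by (intro F.genideal_minimal) auto
  then show ?thesis using p v by auto
qed

end

section \<open>Rewriting products into the span of the monomials\<close>

text \<open>The relations are imposed on elements of an abstract algebra, with the braid relation solved for the word
  \<open>T_(i+1) T_i T_(i+1)\<close>, which does not occur in the ordered monomials.\<close>

locale covering_relations = ring A for A :: "('k::field, 'a) module" (structure) +
  fixes Z :: 'a and T :: "nat \<Rightarrow> 'a" and n :: nat and c d :: 'k
  assumes smult_closed [simp]: "x \<in> carrier A \<Longrightarrow> r \<odot> x \<in> carrier A"
    and smult_neg: "x \<in> carrier A \<Longrightarrow> (- r) \<odot> x = \<ominus> (r \<odot> x)"
    and smult_r_distr: "x \<in> carrier A \<Longrightarrow> y \<in> carrier A \<Longrightarrow> r \<odot> (x \<oplus> y) = r \<odot> x \<oplus> r \<odot> y"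
    and smult_l_assoc: "x \<in> carrier A \<Longrightarrow> y \<in> carrier A \<Longrightarrow> (r \<odot> x) \<otimes> y = r \<odot> (x \<otimes> y)"
    and smult_r_assoc: "x \<in> carrier A \<Longrightarrow> y \<in> carrier A \<Longrightarrow> x \<otimes> (r \<odot> y) = r \<odot> (x \<otimes> y)"
    and Z_closed [simp]: "Z \<in> carrier A"
    and T_closed [simp]: "1 \<le> i \<Longrightarrow> i < n \<Longrightarrow> T i \<in> carrier A"
    and Z_square: "Z \<otimes> Z = \<one>"
    and Z_central: "x \<in> carrier A \<Longrightarrow> x \<otimes> Z = Z \<otimes> x"
    and T_square: "1 \<le> i \<Longrightarrow> i < n \<Longrightarrow> T i \<otimes> T i = c \<odot> Z \<oplus> \<one>"
    and T_far: "1 \<le> j \<Longrightarrow> j + 1 < i \<Longrightarrow> i < n \<Longrightarrow> T i \<otimes> T j = Z \<otimes> (T j \<otimes> T i)"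
    and T_braid: "1 \<le> i \<Longrightarrow> i + 1 < n \<Longrightarrow>
      T (i + 1) \<otimes> T i \<otimes> T (i + 1) = T i \<otimes> T (i + 1) \<otimes> T i \<oplus> d \<odot> T i \<ominus> d \<odot> T (i + 1)"
begin

primrec Tdesc :: "nat \<Rightarrow> nat \<Rightarrow> 'a" where
  "Tdesc i 0 = \<one>"
| "Tdesc i (Suc a) = Tdesc i a \<otimes> T (i - a)"

primrec Tprod :: "(nat \<Rightarrow> nat) \<Rightarrow> nat \<Rightarrow> 'a" where
  "Tprod a 0 = \<one>"
| "Tprod a (Suc k) = Tprod a k \<otimes> Tdesc (Suc k) (a (Suc k))"

lemma Tdesc_closed [simp]: "i < n \<Longrightarrow> a \<le> i \<Longrightarrow> Tdesc i a \<in> carrier A"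
  by (induction a) auto

lemma Tdesc_add:
  assumes "i < n" "a + b \<le> i" shows "Tdesc i (a + b) = Tdesc i a \<otimes> Tdesc (i - a) b"
  using assms(2) by (induction b) (use assms(1) in \<open>simp_all add: m_assoc\<close>)

text \<open>Since the span of the monomials is closed under multiplication by \<open>Z\<close>, the exact power of \<open>Z\<close>
  produced by reordering is irrelevant for spanning.\<close>

definition eqZ :: "'a \<Rightarrow> 'a \<Rightarrow> bool" (infix \<open>\<approx>\<close> 50) where
  "x \<approx> y \<longleftrightarrow> x = y \<or> x = Z \<otimes> y"

lemma Z_Z_left: "x \<in> carrier A \<Longrightarrow> Z \<otimes> (Z \<otimes> x) = x"
  by (simp add: m_assoc[symmetric] Z_square)

lemma Z_left_commute: "x \<in> carrier A \<Longrightarrow> y \<in> carrier A \<Longrightarrow> x \<otimes> (Z \<otimes> y) = Z \<otimes> (x \<otimes> y)"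
  by (metis m_assoc Z_central Z_closed)

lemma eqZ_trans: "x \<approx> y \<Longrightarrow> y \<approx> z \<Longrightarrow> z \<in> carrier A \<Longrightarrow> x \<approx> z"
  by (auto simp: eqZ_def Z_Z_left)

lemma eqZ_mult_left: "x \<approx> y \<Longrightarrow> y \<in> carrier A \<Longrightarrow> w \<in> carrier A \<Longrightarrow> w \<otimes> x \<approx> w \<otimes> y"
  by (auto simp: eqZ_def Z_left_commute)

lemma eqZ_mult_right: "x \<approx> y \<Longrightarrow> y \<in> carrier A \<Longrightarrow> w \<in> carrier A \<Longrightarrow> x \<otimes> w \<approx> y \<otimes> w"
  by (auto simp: eqZ_def m_assoc)

lemma eqZ_sym: "x \<approx> y \<Longrightarrow> y \<in> carrier A \<Longrightarrow> y \<approx> x"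
  by (auto simp: eqZ_def Z_Z_left)

lemma eqZ_commute_mult:
  assumes "x \<otimes> u \<approx> u \<otimes> x" "y \<otimes> u \<approx> u \<otimes> y" and c: "x \<in> carrier A" "y \<in> carrier A" "u \<in> carrier A"
  shows "(x \<otimes> y) \<otimes> u \<approx> u \<otimes> (x \<otimes> y)"
proof (rule eqZ_trans)
  show "(x \<otimes> y) \<otimes> u \<approx> x \<otimes> (u \<otimes> y)"
    using eqZ_mult_left[OF assms(2)] c by (simp add: m_assoc)
  show "x \<otimes> (u \<otimes> y) \<approx> u \<otimes> (x \<otimes> y)"
    using eqZ_mult_right[OF assms(1)] c by (simp add: m_assoc[symmetric])
qed (use c in simp)

lemma T_far_eqZ:
  assumes "1 \<le> i" "i < n" "1 \<le> j" "j < n" "i + 1 < j \<or> j + 1 < i"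
  shows "T i \<otimes> T j \<approx> T j \<otimes> T i"
  using assms T_far[of i j] T_far[of j i] by (auto simp: eqZ_def Z_Z_left)

lemma Tdesc_T_far:
  assumes "i < n" "a \<le> i" "1 \<le> j" "j < n" "i + 1 < j \<or> j < i - a"
  shows "Tdesc i a \<otimes> T j \<approx> T j \<otimes> Tdesc i a"
  using assms(2,5)
proof (induction a)
  case 0
  then show ?case using assms by (simp add: eqZ_def)
next
  case (Suc a)
  have "Tdesc i a \<otimes> T j \<approx> T j \<otimes> Tdesc i a"
    by (rule Suc.IH) (use Suc.prems in auto)
  moreover have "T (i - a) \<otimes> T j \<approx> T j \<otimes> T (i - a)"
    using assms Suc.prems by (intro T_far_eqZ) auto
  ultimately show ?case
    unfolding Tdesc.simps using assms Suc.prems by (intro eqZ_commute_mult) auto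
qed

lemma Tdesc_Tdesc_far:
  assumes "i < n" "a \<le> i" "k < i - a" "b \<le> k"
  shows "Tdesc i a \<otimes> Tdesc k b \<approx> Tdesc k b \<otimes> Tdesc i a"
proof -
  have "Tdesc k b \<otimes> Tdesc i a \<approx> Tdesc i a \<otimes> Tdesc k b"
    using assms(4)
  proof (induction b)
    case 0
    then show ?case using assms by (simp add: eqZ_def)
  next
    case (Suc b)
    have "Tdesc i a \<otimes> T (k - b) \<approx> T (k - b) \<otimes> Tdesc i a"
      using assms Suc.prems by (intro Tdesc_T_far) auto
    then have "T (k - b) \<otimes> Tdesc i a \<approx> Tdesc i a \<otimes> T (k - b)"
      by (rule eqZ_sym) (use assms Suc.prems in auto)
    then show ?case
      unfolding Tdesc.simps using assms Suc by (intro eqZ_commute_mult) auto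
  qed
  then show ?thesis by (rule eqZ_sym) (use assms in auto)
qed

text \<open>The linear span, defined inductively so that linear maps are treated by rule induction.\<close>

inductive_set lin_hull :: "'a set \<Rightarrow> 'a set" for B where
  zero: "\<zero> \<in> lin_hull B"
| base: "x \<in> B \<Longrightarrow> x \<in> lin_hull B"
| add: "x \<in> lin_hull B \<Longrightarrow> y \<in> lin_hull B \<Longrightarrow> x \<oplus> y \<in> lin_hull B"
| smult: "x \<in> lin_hull B \<Longrightarrow> r \<odot> x \<in> lin_hull B"

lemma lin_hull_carrier: "x \<in> lin_hull B \<Longrightarrow> B \<subseteq> carrier A \<Longrightarrow> x \<in> carrier A"
  by (induction rule: lin_hull.induct) auto

definition monomials :: "nat \<Rightarrow> 'a set" where
  "monomials m = {Z [^] e \<otimes> Tprod a m | e a. e < (2::nat) \<and> (\<forall>i\<in>{1..m}. a i \<le> i)}"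

abbreviation "monomial_span m \<equiv> lin_hull (monomials m)"

lemma Tprod_closed [simp]: "m < n \<Longrightarrow> (\<And>i. i \<in> {1..m} \<Longrightarrow> a i \<le> i) \<Longrightarrow> Tprod a m \<in> carrier A"
  by (induction m) auto

lemma Tprod_cong: "(\<And>i. i \<in> {1..m} \<Longrightarrow> a i = b i) \<Longrightarrow> Tprod a m = Tprod b m"
  by (induction m) auto

lemma monomials_carrier: "m < n \<Longrightarrow> monomials m \<subseteq> carrier A"
  unfolding monomials_def using Tprod_closed by fastforce

lemma hull_carrier: "m < n \<Longrightarrow> x \<in> monomial_span m \<Longrightarrow> x \<in> carrier A"
  using lin_hull_carrier monomials_carrier by blast

lemma monomials_hullI:
  assumes "e < (2::nat)" "\<forall>i\<in>{1..m}. a i \<le> i" shows "Z [^] e \<otimes> Tprod a m \<in> monomial_span m"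
  using assms unfolding monomials_def by (intro lin_hull.base) blast

lemma monomialsE:
  assumes "x \<in> monomials m"
  obtains e a where "x = Z [^] e \<otimes> Tprod a m" "e < (2::nat)" "\<forall>i\<in>{1..m}. a i \<le> i"
  using assms unfolding monomials_def by blast

lemma hull_map:
  assumes "x \<in> monomial_span m" and "m < n"
    and base: "\<And>x. x \<in> monomials m \<Longrightarrow> f x \<in> lin_hull B"
    and zero: "f \<zero> = \<zero>"
    and add: "\<And>x y. x \<in> carrier A \<Longrightarrow> y \<in> carrier A \<Longrightarrow> f (x \<oplus> y) = f x \<oplus> f y"
    and smult: "\<And>r x. x \<in> carrier A \<Longrightarrow> f (r \<odot> x) = r \<odot> f x"
  shows "f x \<in> lin_hull B"
  using assms(1)
proof (induction rule: lin_hull.induct)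
  case zero
  then show ?case using \<open>f \<zero> = \<zero>\<close> lin_hull.zero by simp
next
  case (base x)
  then show ?case by (rule assms(3))
next
  case (add x y)
  then show ?case using assms(5) hull_carrier[OF assms(2)] lin_hull.add by simp
next
  case (smult x r)
  then show ?case using assms(6) hull_carrier[OF assms(2)] lin_hull.smult by simp
qed

lemma hull_Z:
  assumes "x \<in> monomial_span m" "m < n" shows "Z \<otimes> x \<in> monomial_span m"
proof (rule hull_map[OF assms])
  fix x assume "x \<in> monomials m"
  then obtain e a where x: "x = Z [^] e \<otimes> Tprod a m" and e: "e < (2::nat)" and a: "\<forall>i\<in>{1..m}. a i \<le> i"
    by (rule monomialsE)
  have [simp]: "Tprod a m \<in> carrier A" using a assms Tprod_closed[of m a] by auto
  have "Z \<otimes> x = Z [^] (1 - e) \<otimes> Tprod a m"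
  proof (cases "e = 0")
    case False
    then have "e = 1" using e by simp
    then show ?thesis by (simp add: x Z_Z_left)
  qed (simp add: x)
  then show "Z \<otimes> x \<in> monomial_span m" using a monomials_hullI[of "1 - e" m a] by simp
qed (simp_all add: r_distr smult_r_assoc)

lemma hull_eqZ: "x \<approx> y \<Longrightarrow> y \<in> monomial_span m \<Longrightarrow> m < n \<Longrightarrow> x \<in> monomial_span m"
  unfolding eqZ_def by (elim disjE ssubst) (assumption, rule hull_Z)

lemma hull_Tdesc_top:
  assumes "x \<in> monomial_span m" "Suc m < n" "b \<le> Suc m"
  shows "x \<otimes> Tdesc (Suc m) b \<in> monomial_span (Suc m)"
proof -
  have D: "Tdesc (Suc m) b \<in> carrier A" by (rule Tdesc_closed) (use assms in auto)
  have "m < n" using assms by simp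
  then show ?thesis
  proof (rule hull_map[OF assms(1)])
    fix x assume "x \<in> monomials m"
    then obtain e a where x: "x = Z [^] e \<otimes> Tprod a m" and e: "e < (2::nat)" and a: "\<forall>i\<in>{1..m}. a i \<le> i"
      by (rule monomialsE)
    let ?a = "a(Suc m := b)"
    have p: "Tprod a m \<in> carrier A" using a assms Tprod_closed[of m a] by auto
    have "Tprod ?a m = Tprod a m" by (rule Tprod_cong) auto
    then have "Tprod ?a (Suc m) = Tprod a m \<otimes> Tdesc (Suc m) b"
      by (simp del: Tdesc.simps)
    then have "x \<otimes> Tdesc (Suc m) b = Z [^] e \<otimes> Tprod ?a (Suc m)"
      using p D unfolding x by (simp add: m_assoc del: Tdesc.simps Tprod.simps)
    moreover have "\<forall>i\<in>{1..Suc m}. ?a i \<le> i" using a assms by auto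
    ultimately show "x \<otimes> Tdesc (Suc m) b \<in> monomial_span (Suc m)"
      using monomials_hullI[OF e, of "Suc m" ?a] by simp
  qed (use D in \<open>simp_all add: l_distr smult_l_assoc del: Tdesc.simps\<close>)
qed

lemma mult_smult_combination:
  assumes "u \<in> carrier A" "v \<in> carrier A" "x \<in> carrier A" "y \<in> carrier A" "w \<in> carrier A"
  shows "u \<otimes> ((x \<oplus> r \<odot> y \<ominus> r \<odot> w) \<otimes> v)
    = u \<otimes> (x \<otimes> v) \<oplus> r \<odot> (u \<otimes> (y \<otimes> v)) \<ominus> r \<odot> (u \<otimes> (w \<otimes> v))"
  using assms by (simp add: minus_eq l_distr r_distr smult_l_assoc smult_r_assoc l_minus r_minus)

text \<open>Here \<open>T_j\<close> and \<open>T_(j-1)\<close> both occur inside the descending product, with \<open>T_j\<close> first. The new letter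
  \<open>T_j\<close> is moved left until it meets them, the braid relation is applied, and the three results are
  rearranged so that the factors of small index come first. The three powers of \<open>Z\<close> may differ, hence the
  separate elements.\<close>

lemma Tdesc_T_high:
  assumes "i < n" "b \<le> i" "j \<le> i" "i + 2 \<le> j + b"
  defines "b' \<equiv> b + j - i - 2"
  obtains x1 x2 x3 where
    "x1 \<in> carrier A" "x2 \<in> carrier A" "x3 \<in> carrier A"
    "Tdesc i b \<otimes> T j \<approx> x1 \<oplus> d \<odot> x2 \<ominus> d \<odot> x3"
    "x1 \<approx> T (j - 1) \<otimes> Tdesc i b"
    "x2 \<approx> Tdesc (j - 1) (b' + 1) \<otimes> Tdesc i (i - j)"
    "x3 \<approx> Tdesc (j - 2) b' \<otimes> Tdesc i (i - j + 1)"
proof -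
  let ?P = "Tdesc i (i - j)" and ?Q = "T j" and ?R = "T (j - 1)" and ?D = "Tdesc (j - 2) b'"
  have b: "b = (i - j) + (2 + b')" and j: "2 \<le> j" "j - 1 - 1 = j - 2" "j - 1 + 1 = j" and b'j: "b' \<le> j - 2"
    using assms by auto
  note A = assms(1-3)
  have bj: "i - j + (2 + b') \<le> i" using b A by simp
  have c [simp]: "?P \<in> carrier A" "?Q \<in> carrier A" "?R \<in> carrier A" "?D \<in> carrier A"
    using A j b'j by auto
  have "Tdesc i b = ?P \<otimes> Tdesc j (2 + b')"
    unfolding b using Tdesc_add[of i "i - j" "2 + b'"] A bj by simp
  also have "Tdesc j (2 + b') = (?Q \<otimes> ?R) \<otimes> ?D"
    using Tdesc_add[of j 2 b'] A j b'j c(2) by (simp add: numeral_2_eq_2)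
  finally have desc: "Tdesc i b = ?P \<otimes> (?Q \<otimes> ?R \<otimes> ?D)" .
  have descc [simp]: "Tdesc i b \<in> carrier A" using A by simp
  have PR: "?P \<otimes> ?R \<approx> ?R \<otimes> ?P"
    using A j by (intro Tdesc_T_far) auto
  have DQ: "?D \<otimes> ?Q \<approx> ?Q \<otimes> ?D"
    using A j b'j by (intro Tdesc_T_far) auto
  show ?thesis
  proof
    let ?x1 = "?P \<otimes> (?R \<otimes> ?Q \<otimes> ?R \<otimes> ?D)" and ?x2 = "?P \<otimes> (?R \<otimes> ?D)" and ?x3 = "?P \<otimes> (?Q \<otimes> ?D)"
    show "?x1 \<in> carrier A" "?x2 \<in> carrier A" "?x3 \<in> carrier A"
      by (simp_all del: One_nat_def)
    have "Tdesc i b \<otimes> ?Q = ?P \<otimes> (?Q \<otimes> ?R) \<otimes> (?D \<otimes> ?Q)"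
      unfolding desc by (simp add: m_assoc del: One_nat_def)
    also have "\<dots> \<approx> ?P \<otimes> (?Q \<otimes> ?R) \<otimes> (?Q \<otimes> ?D)"
      by (rule eqZ_mult_left[OF DQ]) (simp_all del: One_nat_def)
    also have "?P \<otimes> (?Q \<otimes> ?R) \<otimes> (?Q \<otimes> ?D) = ?P \<otimes> ((?Q \<otimes> ?R \<otimes> ?Q) \<otimes> ?D)"
      by (simp add: m_assoc del: One_nat_def)
    also have "?Q \<otimes> ?R \<otimes> ?Q = ?R \<otimes> ?Q \<otimes> ?R \<oplus> d \<odot> ?R \<ominus> d \<odot> ?Q"
      using T_braid[of "j - 1"] A j by (simp del: One_nat_def)
    also have "?P \<otimes> ((?R \<otimes> ?Q \<otimes> ?R \<oplus> d \<odot> ?R \<ominus> d \<odot> ?Q) \<otimes> ?D)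
        = ?x1 \<oplus> d \<odot> ?x2 \<ominus> d \<odot> ?x3"
      by (rule mult_smult_combination) (simp_all del: One_nat_def)
    finally show "Tdesc i b \<otimes> ?Q \<approx> ?x1 \<oplus> d \<odot> ?x2 \<ominus> d \<odot> ?x3" .
    show "?x1 \<approx> ?R \<otimes> Tdesc i b"
      using eqZ_mult_right[OF PR, of "?Q \<otimes> ?R \<otimes> ?D"] by (simp add: desc m_assoc del: One_nat_def)
    have "Tdesc (j - 1) (b' + 1) = ?R \<otimes> ?D"
      using Tdesc_add[of "j - 1" 1 b'] A j b'j c(3) by (simp add: add.commute)
    then show "?x2 \<approx> Tdesc (j - 1) (b' + 1) \<otimes> ?P"
      using Tdesc_Tdesc_far[of i "i - j" "j - 1" "b' + 1"] A j b'j
      by (simp del: One_nat_def Tdesc.simps)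
    have "i - (i - j) = j" using A by simp
    then have "Tdesc i (i - j + 1) = ?P \<otimes> ?Q"
      by simp
    then show "?x3 \<approx> ?D \<otimes> Tdesc i (i - j + 1)"
      using Tdesc_Tdesc_far[of i "i - j + 1" "j - 2" b'] A j b'j by (simp add: m_assoc)
  qed
qed

text \<open>By induction on \<open>m\<close>: a monomial of level \<open>m + 1\<close> is \<open>y\<close> times a descending product that starts with
  \<open>T_(m+1)\<close>, where \<open>y\<close> has level \<open>m\<close>. According to the position of \<open>j\<close>, multiplication by \<open>T_j\<close> passes \<open>T_j\<close>
  through the product, lengthens it, shortens it, or falls under \<open>Tdesc_T_high\<close>. In each case the result is a
  combination of elements of level \<open>m\<close> times descending products.\<close>

lemma hull_T: "x \<in> monomial_span m \<Longrightarrow> m < n \<Longrightarrow> 1 \<le> j \<Longrightarrow> j \<le> m \<Longrightarrow> x \<otimes> T j \<in> monomial_span m"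
proof (induction m arbitrary: x j)
  case 0
  then show ?case by simp
next
  case (Suc m)
  let ?i = "Suc m"
  note IH = Suc.IH
  have desc: "x \<otimes> Tdesc k b \<in> monomial_span m" if "x \<in> monomial_span m" "k \<le> m" "b \<le> k" for x k b
    using that(3)
  proof (induction b)
    case 0
    then show ?case using that Suc.prems hull_carrier[of m x] by simp
  next
    case (Suc b)
    then have "(x \<otimes> Tdesc k b) \<otimes> T (k - b) \<in> monomial_span m"
      using that Suc.prems \<open>Suc m < n\<close> by (intro IH) auto
    then show ?case using that Suc.prems \<open>Suc m < n\<close> hull_carrier[of m x] by (simp add: m_assoc)
  qed
  have T: "x \<otimes> T j \<in> monomial_span m" if "x \<in> monomial_span m" "1 \<le> j" "j \<le> m" for x j
    using that Suc.IH[of x j] Suc.prems by simp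
  have step: "x \<in> monomial_span ?i" if "x \<approx> y \<otimes> (u \<otimes> Tdesc ?i b)" "y \<otimes> u \<in> monomial_span m" "b \<le> ?i"
     "y \<in> carrier A" "u \<in> carrier A" for x y u b
    using hull_eqZ[OF that(1), of ?i] hull_Tdesc_top[OF that(2), of b] that Suc.prems
    by (simp add: m_assoc del: Tdesc.simps)
  have main: "y \<otimes> Tdesc ?i b \<otimes> T j \<in> monomial_span ?i" if y: "y \<in> monomial_span m" and b: "b \<le> ?i" and j: "1 \<le> j" "j \<le> ?i" for y b j
  proof -
    have n: "?i < n" using Suc.prems by simp
    have cl [simp]: "y \<in> carrier A" "T j \<in> carrier A" "Tdesc ?i b \<in> carrier A"
      using hull_carrier[OF _ y] b j n by (auto simp del: Tdesc.simps)
    consider "j < ?i - b" | "j = ?i - b" | "j = ?i - b + 1" "b \<ge> 1" | "?i + 2 \<le> j + b"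
      using b j
      by (cases "j < ?i - b"; cases "j = ?i - b"; cases "j = ?i - b + 1") auto
    then show ?thesis
    proof cases
      case 1
      then have "Tdesc ?i b \<otimes> T j \<approx> T j \<otimes> Tdesc ?i b"
        using n j b by (intro Tdesc_T_far) auto
      then have "y \<otimes> (Tdesc ?i b \<otimes> T j) \<approx> y \<otimes> (T j \<otimes> Tdesc ?i b)"
        by (rule eqZ_mult_left) simp_all
      then show ?thesis
        using T[OF y j(1)] 1 b by (intro step[of _ y "T j" b]) (simp_all add: m_assoc)
    next
      case 2
      then have "y \<otimes> Tdesc ?i b \<otimes> T j = y \<otimes> Tdesc ?i (Suc b)"
        using cl by (simp add: m_assoc)
      then show ?thesis using hull_Tdesc_top[OF y, of "Suc b"] 2 n j by simp
    next
      case 3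
      then obtain b' where b': "b = Suc b'" by (cases b) auto
      have cl' [simp]: "Tdesc ?i b' \<in> carrier A" using b b' n by simp
      have "j = ?i - b'" using 3 b b' by simp
      then have "y \<otimes> Tdesc ?i b \<otimes> T j = y \<otimes> Tdesc ?i b' \<otimes> (T j \<otimes> T j)"
        using cl by (simp add: m_assoc b')
      also have "\<dots> = c \<odot> (Z \<otimes> (y \<otimes> Tdesc ?i b')) \<oplus> y \<otimes> Tdesc ?i b'"
        using T_square[of j] j n
        by (simp add: r_distr smult_r_assoc Z_central del: Tdesc.simps)
      finally show ?thesis
        using hull_Tdesc_top[OF y, of b'] b b' n
        by (simp add: lin_hull.add lin_hull.smult hull_Z del: Tdesc.simps)
    next
      case 4
      define b' where "b' = b + j - ?i - 2"
      have j2: "j \<ge> 2" and b'j: "b' + 2 \<le> j" using 4 b by (auto simp: b'_def)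
      obtain x1 x2 x3 where c: "x1 \<in> carrier A" "x2 \<in> carrier A" "x3 \<in> carrier A"
        and x: "Tdesc ?i b \<otimes> T j \<approx> x1 \<oplus> d \<odot> x2 \<ominus> d \<odot> x3"
        and x1: "x1 \<approx> T (j - 1) \<otimes> Tdesc ?i b"
        and x2: "x2 \<approx> Tdesc (j - 1) (b' + 1) \<otimes> Tdesc ?i (?i - j)"
        and x3: "x3 \<approx> Tdesc (j - 2) b' \<otimes> Tdesc ?i (?i - j + 1)"
        using Tdesc_T_high[of ?i b j] 4 b j n unfolding b'_def by metis
      have m1: "y \<otimes> x1 \<in> monomial_span ?i"
        using T[OF y, of "j - 1"] j2 j b n
        by (intro step[OF eqZ_mult_left[OF x1]]) (auto simp del: Tdesc.simps)
      have m2: "y \<otimes> x2 \<in> monomial_span ?i"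
        using desc[OF y, of "j - 1" "b' + 1"] b'j j n
        by (intro step[OF eqZ_mult_left[OF x2]]) (auto simp del: Tdesc.simps)
      have m3: "y \<otimes> x3 \<in> monomial_span ?i"
        using desc[OF y, of "j - 2" b'] b'j j n
        by (intro step[OF eqZ_mult_left[OF x3]]) (auto simp del: Tdesc.simps)
      have "y \<otimes> (Tdesc ?i b \<otimes> T j) \<approx> y \<otimes> (x1 \<oplus> d \<odot> x2 \<ominus> d \<odot> x3)"
        by (rule eqZ_mult_left[OF x]) (use c in auto)
      also have "y \<otimes> (x1 \<oplus> d \<odot> x2 \<ominus> d \<odot> x3) = y \<otimes> x1 \<oplus> d \<odot> (y \<otimes> x2) \<oplus> (- d) \<odot> (y \<otimes> x3)"
        using c by (simp add: minus_eq r_distr smult_r_assoc r_minus smult_neg a_assoc)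
      finally show ?thesis
        using m1 m2 m3 hull_eqZ n by (simp add: lin_hull.add lin_hull.smult m_assoc del: Tdesc.simps)
    qed
  qed
  have Tj: "T j \<in> carrier A" using Suc.prems by auto
  show ?case
  proof (rule hull_map[where f = "\<lambda>x. x \<otimes> T j" and m = ?i])
    show "x \<in> monomial_span ?i" "?i < n" using Suc.prems by simp_all
    fix x assume "x \<in> monomials ?i"
    then obtain e a where x: "x = Z [^] e \<otimes> Tprod a ?i" and e: "e < (2::nat)" and a: "\<forall>i\<in>{1..?i}. a i \<le> i"
      by (rule monomialsE)
    have p: "Tprod a m \<in> carrier A" "Tdesc ?i (a ?i) \<in> carrier A"
      using a Suc.prems Tprod_closed[of m a] Tdesc_closed[of ?i "a ?i"] by auto
    then have "x = Z [^] e \<otimes> Tprod a m \<otimes> Tdesc ?i (a ?i)"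
      by (simp add: x m_assoc del: Tdesc.simps)
    moreover have "Z [^] e \<otimes> Tprod a m \<in> monomial_span m"
      using a e by (intro monomials_hullI) auto
    moreover have "a ?i \<le> ?i" using a by auto
    ultimately show "x \<otimes> T j \<in> monomial_span ?i" using main Suc.prems by simp
  qed (use Tj in \<open>simp_all add: l_distr smult_l_assoc\<close>)
qed

lemma one_in_hull: "\<one> \<in> monomial_span m"
proof -
  have "Tdesc i 0 = \<one>" for i by simp
  then have "Tprod (\<lambda>_. 0) m = \<one>" by (induction m) auto
  then show ?thesis using monomials_hullI[of 0 m "\<lambda>_. 0"] by simp
qed

lemma hull_mult_Z: "x \<in> monomial_span m \<Longrightarrow> m < n \<Longrightarrow> x \<otimes> Z \<in> monomial_span m"
  by (simp add: Z_central hull_carrier hull_Z)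

end

section \<open>The covering Hecke algebra satisfies the relations\<close>

lemma coset_eq_iff:
  assumes I: "ideal I (free_algebra X)" and p: "p \<in> carrier (free_algebra X)" and r: "r \<in> carrier (free_algebra X)"
  shows "I +>\<^bsub>free_algebra X\<^esub> p = I +>\<^bsub>free_algebra X\<^esub> r \<longleftrightarrow> p - r \<in> I"
proof -
  interpret ideal I "free_algebra X" by (rule I)
  have "p \<in> I +>\<^bsub>free_algebra X\<^esub> r \<longleftrightarrow> p - r \<in> I"
  proof
    assume "p \<in> I +>\<^bsub>free_algebra X\<^esub> r"
    then obtain i where "i \<in> I" "p = i + r" by (auto simp: a_r_coset_def')
    then show "p - r \<in> I" by simp
  next
    assume "p - r \<in> I"
    then show "p \<in> I +>\<^bsub>free_algebra X\<^esub> r"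
      by (auto simp: a_r_coset_def' intro!: bexI[of _ "p - r"])
  qed
  then show ?thesis
    using a_rcos_self[OF p] a_repr_independence'[of p r] r by auto
qed

abbreviation coset :: "nat \<Rightarrow> (hecke_gen, ratfun) ncpoly \<Rightarrow> (hecke_gen, ratfun) ncpoly set" where
  "coset n p \<equiv> hecke_ideal n +>\<^bsub>hecke_free n\<^esub> p"

lemma carrier_fz: "fz \<in> carrier (hecke_free n)"
  and carrier_fT: "1 \<le> i \<Longrightarrow> i < n \<Longrightarrow> fT i \<in> carrier (hecke_free n)"
  by (auto simp: hecke_gens_def intro!: free_algebra_closed)

lemmas coset_ops = quot_free_ops[OF ideal_hecke_ideal, folded covering_hecke_def]
lemma coset_closed: "p \<in> carrier (hecke_free n) \<Longrightarrow> coset n p \<in> carrier (covering_hecke n)"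
  by (rule coset_ops(3))
lemmas coset_smult = quot_free_smult[OF ideal_hecke_ideal, folded covering_hecke_def]
lemmas coset_eq = coset_eq_iff[OF ideal_hecke_ideal]
lemmas fcarrier = free_algebra_closed carrier_fz carrier_fT

lemma rel_in_ideal: "r \<in> hecke_rels n \<Longrightarrow> r \<in> hecke_ideal n"
  using ring.genideal_self[OF ring_free_algebra hecke_rels_subset] unfolding hecke_ideal_def by blast

lemma coset_cases:
  assumes "U \<in> carrier (covering_hecke n)"
  obtains p where "p \<in> carrier (hecke_free n)" "U = coset n p"
  using assms unfolding covering_hecke_def by (rule quot_free_cases[OF ideal_hecke_ideal])

lemma one_coset: "\<one>\<^bsub>covering_hecke n\<^esub> = coset n 1"
  and zero_coset: "\<zero>\<^bsub>covering_hecke n\<^esub> = coset n 0"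
proof -
  show "\<one>\<^bsub>covering_hecke n\<^esub> = coset n 1"
    by (simp add: covering_hecke_def quot_algebra_simps FactRing_def)
  interpret ideal "hecke_ideal n" "hecke_free n" by (rule ideal_hecke_ideal)
  show "\<zero>\<^bsub>covering_hecke n\<^esub> = coset n 0"
    using a_rcos_zero[OF ideal_hecke_ideal[of n], of 0] additive_subgroup.zero_closed[of "hecke_ideal n" "hecke_free n"]
      is_additive_subgroup
    by (simp add: covering_hecke_def quot_algebra_simps FactRing_def)
qed

abbreviation "hecke_c \<equiv> hecke_q^2 + inverse hecke_q^2 + 1"

lemma covering_relations_hecke:
  "covering_relations (covering_hecke n) (hecke_z n) (hecke_T n) n hecke_c (hecke_eps^2)"
proof -
  interpret VS: vectorspace class_ring "covering_hecke n" by (rule vectorspace_covering_hecke)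
  interpret R: ring "covering_hecke n" by (rule ring_covering_hecke)
  let ?A = "covering_hecke n"
  have minus: "coset n p \<ominus>\<^bsub>?A\<^esub> coset n r = coset n (p - r)"
    if "p \<in> carrier (hecke_free n)" "r \<in> carrier (hecke_free n)" for p r
  proof -
    have "\<ominus>\<^bsub>?A\<^esub> coset n r = coset n (- r)"
      by (rule VS.minus_equality) (use that in \<open>simp_all add: coset_ops coset_closed fcarrier zero_coset\<close>)
    then show ?thesis using that by (simp add: a_minus_def coset_ops coset_closed fcarrier)
  qed
  show ?thesis
  proof (intro covering_relations.intro covering_relations_axioms.intro)
    show "ring ?A" by (rule ring_covering_hecke)
    fix x y r assume x: "x \<in> carrier ?A"
    then obtain p where p: "p \<in> carrier (hecke_free n)" "x = coset n p" by (rule coset_cases)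
    show "r \<odot>\<^bsub>?A\<^esub> x \<in> carrier ?A" using p by (simp add: coset_ops coset_closed coset_smult fcarrier)
    have "scalar (- r) = - (scalar r :: (hecke_gen, ratfun) ncpoly)" by (simp add: scalar_def single_uminus)
    then have "(- r) \<odot>\<^bsub>?A\<^esub> x \<oplus>\<^bsub>?A\<^esub> r \<odot>\<^bsub>?A\<^esub> x = \<zero>\<^bsub>?A\<^esub>"
      using p by (simp add: coset_ops coset_closed coset_smult fcarrier zero_coset)
    then show "(- r) \<odot>\<^bsub>?A\<^esub> x = \<ominus>\<^bsub>?A\<^esub> (r \<odot>\<^bsub>?A\<^esub> x)"
      using p by (intro VS.minus_equality[symmetric]) (simp_all add: coset_ops coset_closed coset_smult fcarrier)
    assume y: "y \<in> carrier ?A"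
    show "r \<odot>\<^bsub>?A\<^esub> (x \<oplus>\<^bsub>?A\<^esub> y) = r \<odot>\<^bsub>?A\<^esub> x \<oplus>\<^bsub>?A\<^esub> r \<odot>\<^bsub>?A\<^esub> y"
      using x y by (simp add: VS.smult_r_distr)
    show "(r \<odot>\<^bsub>?A\<^esub> x) \<otimes>\<^bsub>?A\<^esub> y = r \<odot>\<^bsub>?A\<^esub> (x \<otimes>\<^bsub>?A\<^esub> y)" 
       "x \<otimes>\<^bsub>?A\<^esub> (r \<odot>\<^bsub>?A\<^esub> y) = r \<odot>\<^bsub>?A\<^esub> (x \<otimes>\<^bsub>?A\<^esub> y)"
      using covering_hecke_smult_mult[OF x y] by simp_all
  next
    show "hecke_z n \<in> carrier ?A" by (simp add: hecke_z_def coset_closed fcarrier)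
    show "hecke_T n i \<in> carrier ?A" if "1 \<le> i" "i < n" for i
      using that by (simp add: hecke_T_def coset_closed fcarrier)
    show "hecke_z n \<otimes>\<^bsub>?A\<^esub> hecke_z n = \<one>\<^bsub>?A\<^esub>"
      by (simp add: hecke_z_def one_coset coset_ops coset_closed fcarrier coset_eq)
        (rule rel_in_ideal, simp add: hecke_rels_def)
    show "x \<otimes>\<^bsub>?A\<^esub> hecke_z n = hecke_z n \<otimes>\<^bsub>?A\<^esub> x" if x: "x \<in> carrier ?A" for x
    proof -
      obtain p where p: "p \<in> carrier (hecke_free n)" "x = coset n p" using x by (rule coset_cases)
      have "fz * p - p * fz \<in> hecke_ideal n"
        by (rule rel_in_ideal) (use p in \<open>auto simp: hecke_rels_def\<close>)
      then have "coset n (fz * p) = coset n (p * fz)" using p by (simp add: coset_eq fcarrier)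
      then show ?thesis using p by (simp add: hecke_z_def coset_ops coset_closed fcarrier)
    qed
    show "hecke_T n i \<otimes>\<^bsub>?A\<^esub> hecke_T n i = hecke_c \<odot>\<^bsub>?A\<^esub> hecke_z n \<oplus>\<^bsub>?A\<^esub> \<one>\<^bsub>?A\<^esub>" if "1 \<le> i" "i < n" for i
    proof -
      have "fT i * fT i - (scalar hecke_c * fz + 1) \<in> hecke_ideal n"
        by (rule rel_in_ideal) (use that in \<open>auto simp: hecke_rels_def\<close>)
      then have "coset n (fT i * fT i) = coset n (scalar hecke_c * fz + 1)"
        using that by (simp add: coset_eq fcarrier)
      then show ?thesis
        using that by (simp add: hecke_z_def hecke_T_def one_coset coset_ops coset_closed coset_smult fcarrier)
    qed
    show "hecke_T n i \<otimes>\<^bsub>?A\<^esub> hecke_T n j = hecke_z n \<otimes>\<^bsub>?A\<^esub> (hecke_T n j \<otimes>\<^bsub>?A\<^esub> hecke_T n i)"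
      if "1 \<le> j" "j + 1 < i" "i < n" for i j
    proof -
      have ij: "i \<in> {1..<n}" "j \<in> {1..<n}" "\<bar>int i - int j\<bar> > 1" using that by auto
      have "fT i * fT j - fz * fT j * fT i \<in> hecke_ideal n"
        by (rule rel_in_ideal) (use ij in \<open>auto simp: hecke_rels_def\<close>)
      then have "coset n (fT i * fT j) = coset n (fz * (fT j * fT i))"
        using that by (simp add: coset_eq fcarrier mult.assoc)
      then show ?thesis
        using that by (simp add: hecke_z_def hecke_T_def coset_ops coset_closed fcarrier)
    qed
    show "hecke_T n (i + 1) \<otimes>\<^bsub>?A\<^esub> hecke_T n i \<otimes>\<^bsub>?A\<^esub> hecke_T n (i + 1)
      = hecke_T n i \<otimes>\<^bsub>?A\<^esub> hecke_T n (i + 1) \<otimes>\<^bsub>?A\<^esub> hecke_T n i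
        \<oplus>\<^bsub>?A\<^esub> hecke_eps\<^sup>2 \<odot>\<^bsub>?A\<^esub> hecke_T n i \<ominus>\<^bsub>?A\<^esub> hecke_eps\<^sup>2 \<odot>\<^bsub>?A\<^esub> hecke_T n (i + 1)"
      if "1 \<le> i" "i + 1 < n" for i
    proof -
      let ?a = "fT i" and ?b = "fT (i + 1)" and ?e = "scalar (hecke_eps^2)"
      have c: "?a \<in> carrier (hecke_free n)" "?b \<in> carrier (hecke_free n)"
        using that by (auto intro: fcarrier)
      have "(?a * ?b * ?a - ?b * ?a * ?b) - ?e * (?b - ?a) \<in> hecke_ideal n"
        by (rule rel_in_ideal) (use that in \<open>auto simp: hecke_rels_def\<close>)
      then have "coset n (?a * ?b * ?a + ?e * ?a - ?e * ?b) = coset n (?b * ?a * ?b)"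
        using c by (simp add: coset_eq fcarrier algebra_simps)
      then show ?thesis
        using c by (simp add: hecke_T_def coset_ops coset_smult minus fcarrier)
    qed
  qed
qed

section \<open>The monomials span\<close>

text \<open>The span contains 1 and is closed under right multiplication by the generators, so it contains the
  coset of every word.\<close>

lemma covering_hecke_spanned:
  assumes "n \<ge> 1" and "U \<in> carrier (covering_hecke n)"
  shows "U \<in> covering_relations.lin_hull (covering_hecke n)
    (covering_relations.monomials (covering_hecke n) (hecke_z n) (hecke_T n) (n - 1))"
proof -
  let ?A = "covering_hecke n"
  interpret C: covering_relations ?A "hecke_z n" "hecke_T n" n hecke_c "hecke_eps^2"
    by (rule covering_relations_hecke)
  have n: "n - 1 < n" using assms by simp
  have word: "coset n (Poly_Mapping.single (Word l) 1) \<in> C.monomial_span (n - 1)" if "set l \<subseteq> hecke_gens n" for l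
    using that
  proof (induction l rule: rev_induct)
    case Nil
    have "Poly_Mapping.single (Word []) 1 = (1 :: (hecke_gen, ratfun) ncpoly)"
      by (simp flip: zero_word_def)
    then show ?case using C.one_in_hull by (simp add: one_coset)
  next
    case (snoc x l)
    let ?w = "Poly_Mapping.single (Word l) 1 :: (hecke_gen, ratfun) ncpoly"
    have "?w * letter x = Poly_Mapping.single (Word (l @ [x])) 1"
      by (simp add: letter_def mult_single plus_word_def)
    moreover have "?w \<in> carrier (hecke_free n)"
      using snoc.prems by (intro free_algebra_carrierI) auto
    moreover have "letter x \<in> carrier (hecke_free n)"
      using snoc.prems by (intro free_algebra_closed) auto
    ultimately have eq: "coset n (Poly_Mapping.single (Word (l @ [x])) 1) = coset n ?w \<otimes>\<^bsub>?A\<^esub> coset n (letter x)"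
      by (simp add: coset_ops)
    have w: "coset n ?w \<in> C.monomial_span (n - 1)" using snoc by simp
    show ?case
    proof (cases x)
      case Gen_z
      then show ?thesis using C.hull_mult_Z[OF w n] unfolding eq by (simp add: hecke_z_def)
    next
      case (Gen_T i)
      then have "1 \<le> i" "i \<le> n - 1" using snoc.prems by (auto simp: hecke_gens_def)
      then show ?thesis using C.hull_T[OF w n, of i] Gen_T unfolding eq by (simp flip: hecke_T_def)
    qed
  qed
  obtain p where p: "p \<in> carrier (hecke_free n)" "U = coset n p" using assms(2) by (rule coset_cases)
  have "coset n p \<in> C.monomial_span (n - 1)" using p(1)
  proof (induction p rule: update_induct)
    case const
    then show ?case using C.lin_hull.zero by (simp add: zero_coset)
  next
    case (update f w c)
    have eq: "Poly_Mapping.update w c f = f + scalar c * Poly_Mapping.single w 1"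
      using update(1,2) by (intro poly_mapping_eqI)
        (auto simp: lookup_update lookup_add lookup_single in_keys_iff when_def scalar_def mult_single)
    have k: "Poly_Mapping.keys (Poly_Mapping.update w c f) = insert w (Poly_Mapping.keys f)"
      using update(2) by (simp add: keys_update)
    then have "set (letters w) \<subseteq> hecke_gens n"
      using free_algebra_carrierD[OF update.prems, of w] by simp
    then have "coset n (Poly_Mapping.single w 1) \<in> C.monomial_span (n - 1)"
       and s: "Poly_Mapping.single w 1 \<in> carrier (hecke_free n)"
      using word[of "letters w"] by (auto intro!: free_algebra_carrierI)
    moreover have f: "f \<in> carrier (hecke_free n)"
      using k free_algebra_carrierD[OF update.prems] by (intro free_algebra_carrierI) auto
    moreover have "coset n (Poly_Mapping.update w c f)
       = coset n f \<oplus>\<^bsub>?A\<^esub> c \<odot>\<^bsub>?A\<^esub> coset n (Poly_Mapping.single w 1)"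
      using s f unfolding eq by (simp add: coset_ops coset_closed coset_smult fcarrier)
    ultimately show ?case
      using update.IH C.lin_hull.add C.lin_hull.smult by simp
  qed
  then show ?thesis using p by simp
qed

section \<open>The monomials are independent\<close>

text \<open>Representatives in the free algebra of the monomials: independence is proved by evaluating these.\<close>

primrec free_desc :: "nat \<Rightarrow> nat \<Rightarrow> (hecke_gen, ratfun) ncpoly" where
  "free_desc i 0 = 1"
| "free_desc i (Suc a) = free_desc i a * fT (i - a)"

primrec free_prod :: "(nat \<Rightarrow> nat) \<Rightarrow> nat \<Rightarrow> (hecke_gen, ratfun) ncpoly" where
  "free_prod a 0 = 1"
| "free_prod a (Suc k) = free_prod a k * free_desc (Suc k) (a (Suc k))"

lemma free_desc_carrier: "i < n \<Longrightarrow> a \<le> i \<Longrightarrow> free_desc i a \<in> carrier (hecke_free n)"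
  by (induction a) (simp_all add: fcarrier)

lemma free_desc_coset: "i < n \<Longrightarrow> a \<le> i \<Longrightarrow> coset n (free_desc i a) = hecke_Tdesc n i a"
  by (induction a) (simp_all add: one_coset hecke_T_def free_desc_carrier fcarrier flip: coset_ops(2))

lemma free_prod_carrier: "k < n \<Longrightarrow> (\<forall>i\<in>{1..k}. a i \<le> i) \<Longrightarrow> free_prod a k \<in> carrier (hecke_free n)"
  by (induction k) (auto intro!: fcarrier free_desc_carrier simp del: free_desc.simps)

lemma free_prod_coset: "k < n \<Longrightarrow> (\<forall>i\<in>{1..k}. a i \<le> i) \<Longrightarrow> coset n (free_prod a k) = hecke_Tprod n a k"
proof (induction k)
  case (Suc k)
  then have "\<forall>i\<in>{1..k}. a i \<le> i" "a (Suc k) \<le> Suc k" by auto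
  then show ?case using Suc
    by (simp add: free_prod_carrier free_desc_carrier free_desc_coset del: free_desc.simps hecke_Tdesc.simps flip: coset_ops(2))
qed (simp add: one_coset)

definition free_monomial :: "nat \<Rightarrow> nat \<times> (nat \<Rightarrow> nat) \<Rightarrow> (hecke_gen, ratfun) ncpoly" where
  "free_monomial n = (\<lambda>(e, a). fz ^ e * free_prod a (n - 1))"

lemma hecke_exps_le: "a \<in> hecke_exps n \<Longrightarrow> \<forall>i\<in>{1..n - 1}. a i \<le> i"
  by (auto simp: hecke_exps_def)

lemma free_monomial_carrier: 
  assumes "n \<ge> 1" "x \<in> {0, 1} \<times> hecke_exps n" shows "free_monomial n x \<in> carrier (hecke_free n)"
  using assms free_prod_carrier[of "n - 1" n "snd x"] hecke_exps_le[of "snd x" n]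
  by (auto simp: free_monomial_def intro!: fcarrier)

lemma free_monomial_coset: 
  assumes "n \<ge> 1" "x \<in> {0, 1} \<times> hecke_exps n"
  shows "coset n (free_monomial n x) = (\<lambda>(e::nat, a). hecke_z n [^]\<^bsub>covering_hecke n\<^esub> e
        \<otimes>\<^bsub>covering_hecke n\<^esub> hecke_Tprod n a (n - 1)) x"
proof -
  interpret C: covering_relations "covering_hecke n" "hecke_z n" "hecke_T n" n hecke_c "hecke_eps^2"
    by (rule covering_relations_hecke)
  obtain e a where x: "x = (e, a)" "e = 0 \<or> e = 1" "a \<in> hecke_exps n" using assms by auto
  have p: "free_prod a (n - 1) \<in> carrier (hecke_free n)" "coset n (free_prod a (n - 1)) = hecke_Tprod n a (n - 1)"
    using assms(1) free_prod_carrier[of "n - 1" n a] free_prod_coset[of "n - 1" n a] hecke_exps_le[OF x(3)] by auto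
  moreover have "hecke_Tprod n a (n - 1) \<in> carrier (covering_hecke n)"
    using coset_closed[OF p(1)] p(2) by simp
  ultimately show ?thesis
    using x by (auto simp: free_monomial_def coset_ops coset_closed fcarrier hecke_z_def simp flip: coset_ops(2))
qed

lemma sum_fun_apply: "(sum f S) y = (\<Sum>x\<in>S. f x y)"
  for f :: "'a \<Rightarrow> 'b \<Rightarrow> 'c::comm_monoid_add"
  by (induction S rule: infinite_finite_induct) simp_all

lemma two_nonzero: "(2 :: ratfun) \<noteq> 0"
proof -
  have two: "(2 :: ratfun) = Fract 2 1"
    unfolding one_add_one[symmetric] One_fract_def by simp
  show ?thesis
    unfolding two Zero_fract_def by (simp add: eq_fract)
qed

text \<open>For each sign \<open>s\<close> the free algebra acts on functions on exponent sequences, \<open>z\<close> by \<open>s\<close>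
  and \<open>T_i\<close> by \<open>gen_act\<close>; the value of \<open>T_i^2\<close> is then \<open>s (q^2 + q^-2 + 1) + 1\<close>.\<close>

locale spin_sign =
  fixes s :: ratfun
  assumes sign: "s * s = 1"
begin

sublocale hecke_params s "s * hecke_c + 1" "hecke_eps^2"
  by unfold_locales (rule sign)

definition hecke_act :: "nat \<Rightarrow> hecke_gen \<Rightarrow> (nat list \<Rightarrow> ratfun) \<Rightarrow> nat list \<Rightarrow> ratfun" where
  "hecke_act n x = (case x of Gen_z \<Rightarrow> fscale s | Gen_T i \<Rightarrow> gen_act (n - 1) i)"

lemma word_action: "word_action fscale (hecke_act n)"
proof -
  have "lin (fscale s)" by (rule module_hom_scale_self)
  then have "lin (hecke_act n x)" for x
    using lin_gen_act by (simp add: hecke_act_def split: hecke_gen.split)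
  then show ?thesis
    by (simp add: word_action_def word_action_axioms_def module_fscale)
qed

sublocale W: word_action fscale "hecke_act n" for n
  by (rule word_action)

lemma act_z: "hecke_act n Gen_z = fscale s" and act_T: "hecke_act n (Gen_T i) = gen_act (n - 1) i"
  by (simp_all add: hecke_act_def)

lemma ev_hecke_ideal:
  assumes "p \<in> hecke_ideal n" and "v \<in> code_space (n - 1)"
  shows "W.ev n p v = 0"
proof (rule W.ev_genideal[where U = "code_space (n - 1)"])
  note h = hecke_repD[OF hecke_rep_gen_act]
  show "subspace (code_space (n - 1))" by (rule subspace_code_space)
  show "hecke_act n x v \<in> code_space (n - 1)" if "x \<in> hecke_gens n" "v \<in> code_space (n - 1)" for x v
    using that subspace_scale[OF subspace_code_space]
    by (auto simp: hecke_gens_def act_z act_T intro!: h(3))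
  show "hecke_rels n \<subseteq> carrier (hecke_free n)" by (rule hecke_rels_subset)
  show "p \<in> Idl\<^bsub>hecke_free n\<^esub> hecke_rels n" using assms(1) by (simp add: hecke_ideal_def)
  show "v \<in> code_space (n - 1)" by (rule assms)
  note ev = W.ev_diff W.ev_add W.ev_mult W.ev_letter W.ev_scalar W.ev_one act_z act_T
  fix r v assume r: "r \<in> hecke_rels n" and v: "v \<in> code_space (n - 1)"
  consider "r = fz * fz - 1" | p where "r = fz * p - p * fz"
    | i where "r = fT i * fT i - (scalar hecke_c * fz + 1)" "1 \<le> i" "i \<le> n - 1"
    | i j where "r = fT i * fT j - fz * fT j * fT i" "1 \<le> i" "i \<le> n - 1" "1 \<le> j" "j \<le> n - 1" "i + 1 < j \<or> j + 1 < i"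
    | i where "r = (fT i * fT (i+1) * fT i - fT (i+1) * fT i * fT (i+1)) - scalar (hecke_eps^2) * (fT (i+1) - fT i)"
      "1 \<le> i" "i + 1 \<le> n - 1"
    using r unfolding hecke_rels_def by fastforce
  then show "W.ev n r v = 0"
  proof cases
    case 1
    then show ?thesis by (simp add: ev s_simps)
  next
    case 2
    then show ?thesis using module_hom.scale[OF W.lin_ev] by (simp add: ev)
  next
    case 3
    have "W.ev n r v = gen_act (n - 1) i (gen_act (n - 1) i v) - (fscale s (fscale hecke_c v) + v)"
      unfolding 3(1) ev ..
    then show ?thesis
      unfolding h(4)[OF 3(2,3) v] by (simp add: fun_eq_iff distrib_right mult.assoc)
  next
    case 4
    have "gen_act (n - 1) j (gen_act (n - 1) i v) = fscale s (gen_act (n - 1) i (gen_act (n - 1) j v))"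
      using h(5)[of j i] h(6)[of i j] 4 v by blast
    then show ?thesis
      by (simp add: 4(1) ev module_hom.scale[OF lin_gen_act])
  next
    case 5
    let ?p = "gen_act (n - 1) i" and ?r = "gen_act (n - 1) (i + 1)"
    have "W.ev n r v = ?p (?r (?p v)) - ?r (?p (?r v)) - fscale (hecke_eps^2) (?r v - ?p v)"
      unfolding 5(1) ev module_hom.scale[OF lin_gen_act] by (simp add: fun_eq_iff algebra_simps)
    then show ?thesis
      unfolding h(7)[OF 5(2,3) v] by simp
  qed
qed

lemma ev_free_desc: "W.ev n (free_desc i a) v = desc (gen_act (n - 1)) i a v"
  by (induction a) (simp_all add: W.ev_mult W.ev_letter W.ev_one act_T)

lemma ev_free_prod: "W.ev n (free_prod a k) v = ordered_act (gen_act (n - 1)) a k v"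
  by (induction k) (simp_all add: W.ev_mult W.ev_one ev_free_desc del: free_desc.simps desc.simps)

lemma ev_free_monomial_vacuum:
  assumes "x \<in> {0, 1} \<times> hecke_exps n"
  shows "W.ev n (free_monomial n x) (delta (replicate (n - 1) 0)) = fscale (s ^ fst x) (delta (code (snd x) (n - 1)))"
proof -
  obtain e a where x: "x = (e, a)" "e = 0 \<or> e = 1" "a \<in> hecke_exps n" using assms by auto
  have "ordered_act (gen_act (n - 1)) a (n - 1) (delta (replicate (n - 1) 0)) = delta (code a (n - 1))"
    using hecke_exps_le[OF x(3)] by (intro ordered_act_vacuum) auto
  then have "W.ev n (free_prod a (n - 1)) (delta (replicate (n - 1) 0)) = delta (code a (n - 1))"
    by (simp only: ev_free_prod)
  then show ?thesis
    using x module_hom.scale[OF W.lin_ev]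
    by (auto simp: free_monomial_def W.ev_mult W.ev_one W.ev_letter act_z simp del: One_nat_def)
qed

text \<open>Applied to the starting vector, the combination becomes a combination of the basis vectors
  indexed by \<open>a\<close>, with coefficient \<open>g (0, a) + s g (1, a)\<close>.\<close>

lemma sum_free_monomial_in_ideal:
  assumes "(\<Sum>x\<in>{0, 1} \<times> hecke_exps n. scalar (g x) * free_monomial n x) \<in> hecke_ideal n"
    and a: "a \<in> hecke_exps n"
  shows "g (0, a) + s * g (1, a) = 0"
proof -
  have fin: "finite (hecke_exps n)" by (auto simp: hecke_exps_def intro!: finite_PiE)
  have c: "code a (n - 1) = code b (n - 1) \<longleftrightarrow> b = a" if "b \<in> hecke_exps n" for b
    using that a unfolding code_inject hecke_exps_def
    by (auto intro: PiE_ext)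
  have "0 = W.ev n (\<Sum>x\<in>{0, 1} \<times> hecke_exps n. scalar (g x) * free_monomial n x) (delta (replicate (n - 1) 0)) (code a (n - 1))"
    using ev_hecke_ideal[OF assms(1) vacuum_in_code_space] by simp
  also have "\<dots> = (\<Sum>x\<in>{0, 1} \<times> hecke_exps n. g x * s ^ fst x * delta (code (snd x) (n - 1)) (code a (n - 1)))"
    unfolding W.ev_sum sum_fun_apply
    by (rule sum.cong[OF refl])
      (simp only: W.ev_mult W.ev_scalar module_hom.scale[OF W.lin_ev] ev_free_monomial_vacuum mult.assoc)
  also have "\<dots> = (\<Sum>e\<in>{0, 1}. \<Sum>b\<in>hecke_exps n. if b = a then g (e, b) * s ^ e else 0)"
    unfolding sum.cartesian_product by (rule sum.cong) (auto simp: delta_def c simp del: One_nat_def)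
  also have "\<dots> = g (0, a) + s * g (1, a)"
    using fin a by simp
  finally show ?thesis by simp
qed

end

text \<open>One sign alone identifies \<open>z\<close> with a scalar; the two signs together separate the coefficients
  of a monomial and of its multiple by \<open>z\<close>, as 2 is invertible.\<close>

lemma free_monomial_independent:
  assumes "(\<Sum>x\<in>{0, 1} \<times> hecke_exps n. scalar (g x) * free_monomial n x) \<in> hecke_ideal n"
    and "x \<in> {0, 1} \<times> hecke_exps n"
  shows "g x = 0"
proof -
  interpret P: spin_sign 1 by unfold_locales simp
  interpret M: spin_sign "-1" by unfold_locales simp
  obtain e a where x: "x = (e, a)" "e = 0 \<or> e = 1" "a \<in> hecke_exps n" using assms(2) by auto
  have "g (0, a) + g (1, a) = 0" "g (0, a) - g (1, a) = 0"
    using P.sum_free_monomial_in_ideal[OF assms(1) x(3)] M.sum_free_monomial_in_ideal[OF assms(1) x(3)] by simp_all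
  then have "2 * g (1, a) = 0" "g (0, a) = g (1, a)" by simp_all
  then show ?thesis using x two_nonzero by auto
qed

section \<open>The basis\<close>

theorem proposition3p10:
  fixes n :: nat
  assumes "n \<ge> 1"
  shows "inj_on (\<lambda>(e::nat, a). hecke_z n [^]\<^bsub>covering_hecke n\<^esub> e
        \<otimes>\<^bsub>covering_hecke n\<^esub> hecke_Tprod n a (n - 1)) ({0, 1} \<times> hecke_exps n)
    \<and> vectorspace.basis class_ring (covering_hecke n)
        ((\<lambda>a. hecke_Tprod n a (n - 1)) ` hecke_exps n
          \<union> (\<lambda>a. hecke_z n \<otimes>\<^bsub>covering_hecke n\<^esub> hecke_Tprod n a (n - 1)) ` hecke_exps n)
    \<and> vectorspace.fin_dim class_ring (covering_hecke n)
    \<and> vectorspace.dim class_ring (covering_hecke n) = 2 * fact n"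
proof -
  let ?A = "covering_hecke n"
  let ?J = "{0::nat, 1} \<times> hecke_exps n"
  define mon where "mon = (\<lambda>(e::nat, a). hecke_z n [^]\<^bsub>?A\<^esub> e \<otimes>\<^bsub>?A\<^esub> hecke_Tprod n a (n - 1))"
  let ?B = "(\<lambda>a. hecke_Tprod n a (n - 1)) ` hecke_exps n
          \<union> (\<lambda>a. hecke_z n \<otimes>\<^bsub>?A\<^esub> hecke_Tprod n a (n - 1)) ` hecke_exps n"
  interpret C: covering_relations ?A "hecke_z n" "hecke_T n" n hecke_c "hecke_eps^2"
    by (rule covering_relations_hecke)
  interpret VS: vectorspace class_ring ?A by (rule vectorspace_covering_hecke)
  have fin: "finite (hecke_exps n)" by (auto simp: hecke_exps_def intro!: finite_PiE)
  have b: "mon x = coset n (free_monomial n x)" if "x \<in> ?J" for x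
    unfolding mon_def using free_monomial_coset[OF assms that] by simp
  have bc: "mon x \<in> carrier ?A" if "x \<in> ?J" for x
    unfolding b[OF that] by (rule coset_closed[OF free_monomial_carrier[OF assms that]])
  have T: "hecke_Tprod n a (n - 1) \<in> carrier ?A" if "a \<in> hecke_exps n" for a
    using free_prod_coset[of "n - 1" n a] coset_closed[OF free_prod_carrier, of "n - 1" n a] hecke_exps_le[OF that] assms
    by simp
  have B: "?B = mon ` ?J"
  proof -
    have "?J = Pair 0 ` hecke_exps n \<union> Pair 1 ` hecke_exps n" by auto
    moreover have "hecke_z n [^]\<^bsub>?A\<^esub> (1::nat) = hecke_z n" by simp
    ultimately show ?thesis
      using T by (simp add: mon_def image_Un image_image del: One_nat_def)
  qed
  have Bc: "mon ` ?J \<subseteq> carrier ?A" using bc by blast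
  have zero: "g x = 0" if "coset n (\<Sum>x\<in>?J. scalar (g x) * free_monomial n x) = \<zero>\<^bsub>?A\<^esub>" "x \<in> ?J" for g x
  proof (rule free_monomial_independent[OF _ that(2)])
    have "(\<Sum>x\<in>S. scalar (g x) * free_monomial n x) \<in> carrier (hecke_free n)" if "S \<subseteq> ?J" for S
      using that by (induction S rule: infinite_finite_induct) (auto intro!: fcarrier free_monomial_carrier[OF assms])
    then show "(\<Sum>x\<in>?J. scalar (g x) * free_monomial n x) \<in> hecke_ideal n"
      using that(1) unfolding zero_coset by (simp add: coset_eq fcarrier)
  qed
  have inj: "inj_on mon ?J"
  proof (rule inj_onI, rule ccontr)
    fix x y assume x: "x \<in> ?J" and y: "y \<in> ?J" and eq: "mon x = mon y" and ne: "x \<noteq> y"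
    \<comment> \<open>Two equal monomials with different exponents would be a linear relation.\<close>
    define g :: "nat \<times> (nat \<Rightarrow> nat) \<Rightarrow> ratfun" where "g = (\<lambda>w. if w = x then 1 else if w = y then - 1 else 0)"
    have "(\<Sum>w\<in>?J. scalar (g w) * free_monomial n w) = (\<Sum>w\<in>{x, y}. scalar (g w) * free_monomial n w)"
      by (rule sum.mono_neutral_right) (use fin x y in \<open>auto simp: g_def scalar_def\<close>)
    also have "\<dots> = free_monomial n x - free_monomial n y"
      using ne by (simp add: g_def scalar_one scalar_def single_uminus)
    finally have "coset n (\<Sum>w\<in>?J. scalar (g w) * free_monomial n w) = coset n (free_monomial n x - free_monomial n y)" by simp
    also have "\<dots> = \<zero>\<^bsub>?A\<^esub>"
      using eq free_monomial_carrier[OF assms x] free_monomial_carrier[OF assms y]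
      unfolding b[OF x] b[OF y] zero_coset by (simp add: coset_eq fcarrier)
    finally have "g x = 0" using x by (rule zero)
    then show False by (simp add: g_def)
  qed
  have lincomb: "VS.lincomb h (mon ` ?J) = coset n (\<Sum>x\<in>?J. scalar (h (mon x)) * free_monomial n x)" for h
  proof -
    have "(\<Sum>x\<in>S. scalar (h (mon x)) * free_monomial n x) \<in> carrier (hecke_free n)
      \<and> VS.lincomb h (mon ` S) = coset n (\<Sum>x\<in>S. scalar (h (mon x)) * free_monomial n x)"
      if "finite S" "S \<subseteq> ?J" for S
      using that
    proof (induction S rule: finite_induct)
      case empty
      then show ?case by (simp add: VS.lincomb_def zero_coset fcarrier)
    next
      case (insert x S)
      have x: "x \<in> ?J" and S: "S \<subseteq> ?J" using insert.prems by auto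
      have notin: "mon x \<notin> mon ` S"
        using inj_on_image_mem_iff[OF inj x S] insert.hyps(2) by blast
      have fb: "finite (mon ` S)" using insert.hyps(1) by (rule finite_imageI)
      have "VS.lincomb h (mon ` insert x S) = h (mon x) \<odot>\<^bsub>?A\<^esub> mon x \<oplus>\<^bsub>?A\<^esub> VS.lincomb h (mon ` S)"
        unfolding VS.lincomb_def image_insert
      proof (rule C.finsum_insert[OF fb notin])
        show "(\<lambda>v. h v \<odot>\<^bsub>?A\<^esub> v) \<in> mon ` S \<rightarrow> carrier ?A"
          using bc S by (intro funcsetI C.smult_closed) blast
        show "h (mon x) \<odot>\<^bsub>?A\<^esub> mon x \<in> carrier ?A"
          using bc[OF x] by (rule C.smult_closed)
      qed
      also have "\<dots> = coset n (scalar (h (mon x)) * free_monomial n x + (\<Sum>x\<in>S. scalar (h (mon x)) * free_monomial n x))"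
        using insert.IH[OF S] free_monomial_carrier[OF assms x] b[OF x]
        by (simp only: coset_smult coset_ops fcarrier)
      finally show ?case
        using insert.IH[OF S] insert.hyps free_monomial_carrier[OF assms x] by (simp add: fcarrier)
    qed
    from this[of ?J] show ?thesis using fin by simp
  qed
  have finB: "finite ?B" using fin by simp
  have indep: "VS.lin_indpt ?B"
    unfolding B
  proof (rule VS.finite_lin_indpt2)
    show "finite (mon ` ?J)" using fin by simp
    show "mon ` ?J \<subseteq> carrier ?A" by (rule Bc)
    show "\<forall>v\<in>mon ` ?J. h v = \<zero>\<^bsub>class_ring\<^esub>" if "VS.lincomb h (mon ` ?J) = \<zero>\<^bsub>?A\<^esub>" for h
    proof
      fix v assume "v \<in> mon ` ?J"
      then obtain x where x: "x \<in> ?J" "v = mon x" by blast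
      show "h v = \<zero>\<^bsub>class_ring\<^esub>"
        using zero[of "\<lambda>x. h (mon x)", OF _ x(1)] that x(2) unfolding lincomb by (simp add: class_ring_simps)
    qed
  qed
  have prod: "C.Tprod a k = hecke_Tprod n a k" for a k
  proof -
    have desc: "C.Tdesc i b = hecke_Tdesc n i b" for i b by (induction b) simp_all
    show ?thesis by (induction k) (simp_all add: desc del: C.Tdesc.simps hecke_Tdesc.simps)
  qed
  have mono: "C.monomials (n - 1) \<subseteq> ?B"
  proof
    fix x assume "x \<in> C.monomials (n - 1)"
    then obtain e a where x: "x = hecke_z n [^]\<^bsub>?A\<^esub> e \<otimes>\<^bsub>?A\<^esub> C.Tprod a (n - 1)"
      and e: "e < (2::nat)" and a: "\<forall>i\<in>{1..n - 1}. a i \<le> i"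
      by (rule C.monomialsE)
    let ?a = "restrict a {1..n - 1}"
    have "?a \<in> hecke_exps n" using a by (auto simp: hecke_exps_def)
    moreover have "C.Tprod a (n - 1) = hecke_Tprod n ?a (n - 1)"
      unfolding prod[symmetric] by (rule C.Tprod_cong) simp
    ultimately have "x = mon (e, ?a)" "(e, ?a) \<in> ?J" using x e by (auto simp: mon_def)
    then show "x \<in> ?B" unfolding B by blast
  qed
  have "VS.span ?B = carrier ?A"
  proof
    have sub: "?B \<subseteq> carrier ?A" unfolding B by (rule Bc)
    then show "VS.span ?B \<subseteq> carrier ?A" by (rule VS.span_is_subset2)
    interpret S: submodule class_ring "VS.span ?B" ?A by (rule VS.span_is_submodule[OF sub])
    show "carrier ?A \<subseteq> VS.span ?B"
    proof
      fix U assume "U \<in> carrier ?A"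
      then have "U \<in> C.monomial_span (n - 1)" by (rule covering_hecke_spanned[OF assms])
      then show "U \<in> VS.span ?B"
      proof (induction rule: C.lin_hull.induct)
        case zero
        show ?case by (rule S.zero_closed)
      next
        case (base x)
        then show ?case using mono VS.in_own_span[OF sub] by blast
      next
        case (add x y)
        then show ?case by (intro S.m_closed)
      next
        case (smult x r)
        then show ?case by (intro S.smult_closed) (simp_all add: class_ring_simps)
      qed
    qed
  qed
  then have basis: "VS.basis ?B"
    using indep Bc unfolding VS.basis_def B by blast
  have "card (hecke_exps n) = fact n"
  proof -
    have shift: "(\<Prod>i = 1..m. Suc i) = fact (Suc m)" for m
      by (induction m) (simp_all add: prod.nat_ivl_Suc' mult.commute)
    have "card (hecke_exps n) = (\<Prod>i = 1..n - 1. Suc i)"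
      by (simp add: hecke_exps_def card_PiE)
    also have "\<dots> = fact n"
      using shift[of "n - 1"] assms by (cases n) (simp_all del: fact_Suc)
    finally show ?thesis .
  qed
  then have "card ?B = 2 * fact n"
    unfolding B card_image[OF inj] by (simp add: card_cartesian_product)
  moreover have "VS.fin_dim"
  proof -
    have "?B \<subseteq> carrier ?A" "VS.span ?B = carrier ?A"
      using basis unfolding VS.basis_def by (simp_all only:)
    with finB show ?thesis unfolding VS.fin_dim_def by (intro exI[of _ ?B] conjI)
  qed
  moreover have "VS.dim = card ?B" by (rule VS.dim_basis[OF finB basis])
  ultimately show ?thesis
    using inj basis unfolding mon_def by (simp only: simp_thms)
qed

end
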